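(* If $n\geq 5$ is an integer, then the generalized Petersen graph $P(n,2)$ is irreducible.
   Context: Graphs are finite, simple and undirected; $d_G(x,y)$ is the distance between $x$ and $y$ in $G$. A vertex $w$ resolves a pair of vertices $u,v$ if $d_G(u,w)\neq d_G(v,w)$. A set $W\subseteq V(G)$ is a resolving set for $G$ if every pair of distinct vertices of $G$ is resolved by some vertex of $W$. The metric dimension $\beta(G)$ is the minimum cardinality of a resolving set for $G$ (with $\beta(K_1)=0$). The threshold dimension is $\tau(G)=\min\{\beta(H): H \text{ contains } G \text{ as a spanning subgraph}\}$, i.e. the minimum metric dimension among all graphs $H$ with $V(H)=V(G)$ and $E(G)\subseteq E(H)$. A graph $G$ is irreducible if $\tau(G)=\beta(G)$. The generalized Petersen graph $P(n,k)$ is the graph with vertex set $\{u_1,\dots,u_n,v_1,\dots,v_n\}$ and edge set $\{v_iv_{i+1},\ u_iv_i,\ u_iu_{i+k} : 1\leq i\leq n\}$, with indices taken modulo $n$. *)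

theory Defs
  imports "Graph_Theory.Graph_Theory"
begin

text \<open>
  A finite simple undirected graph is a \<^locale>\<open>pair_graph\<close>: a finite, loop-free, symmetric set of
  ordered pairs over a finite vertex set, an undirected edge being a pair of opposite arcs.
\<close>

text \<open>Shortest-path distance with unit arc weights; it is infinite between different components.\<close>

definition graph_dist :: "'a pair_pre_digraph \<Rightarrow> 'a \<Rightarrow> 'a \<Rightarrow> ereal" where
  "graph_dist G u v = wf_digraph.\<mu> (with_proj G) (\<lambda>_. 1) u v"

definition resolves :: "'a pair_pre_digraph \<Rightarrow> 'a \<Rightarrow> 'a \<Rightarrow> 'a \<Rightarrow> bool" where
  "resolves G w u v \<longleftrightarrow> graph_dist G u w \<noteq> graph_dist G v w"

definition resolving_set :: "'a pair_pre_digraph \<Rightarrow> 'a set \<Rightarrow> bool" where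
  "resolving_set G W \<longleftrightarrow> W \<subseteq> pverts G \<and>
     (\<forall>u\<in>pverts G. \<forall>v\<in>pverts G. u \<noteq> v \<longrightarrow> (\<exists>w\<in>W. resolves G w u v))"

definition metric_dimension :: "'a pair_pre_digraph \<Rightarrow> nat" where
  "metric_dimension G = (LEAST k. \<exists>W. resolving_set G W \<and> card W = k)"

definition threshold_dimension :: "'a pair_pre_digraph \<Rightarrow> nat" where
  "threshold_dimension G =
     (LEAST k. \<exists>H. pair_graph H \<and> spanning (with_proj G) (with_proj H) \<and> metric_dimension H = k)"

definition irreducible_graph :: "'a pair_pre_digraph \<Rightarrow> bool" where
  "irreducible_graph G \<longleftrightarrow> threshold_dimension G = metric_dimension G"

text \<open>
  In the generalized Petersen graph, \<open>Inner i\<close> is the vertex \<open>u\<^sub>i\<close> and \<open>Outer i\<close> is \<open>v\<^sub>i\<close>; the residues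
  modulo \<open>n\<close> are represented by \<open>0, \<dots>, n - 1\<close>.
\<close>

datatype petersen_vertex = Inner nat | Outer nat

definition petersen_arcs :: "nat \<Rightarrow> nat \<Rightarrow> petersen_vertex rel" where
  "petersen_arcs n k =
     (\<Union>i<n. {(Outer i, Outer ((i + 1) mod n)),
             (Inner i, Outer i),
             (Inner i, Inner ((i + k) mod n))})"

definition petersen :: "nat \<Rightarrow> nat \<Rightarrow> petersen_vertex pair_pre_digraph" where
  "petersen n k =
     \<lparr> pverts = Inner ` {..<n} \<union> Outer ` {..<n},
       parcs = petersen_arcs n k \<union> (petersen_arcs n k)\<inverse> \<rparr>"

text \<open>The minima above are taken over nonempty sets.\<close>

lemma graph_dist_eq_0_iff:
  assumes "pair_graph G" and u: "u \<in> pverts G"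
  shows "graph_dist G u v = 0 \<longleftrightarrow> u = v"
proof -
  interpret pair_graph G by fact
  have cost: "awalk_cost (\<lambda>_. 1) p = real (length p)" for p :: "('a \<times> 'a) list"
    by (induction p) auto
  show ?thesis
  proof
    assume "u = v"
    have "awalk u [] u" using u by (simp add: awalk_Nil_iff)
    then have "graph_dist G u u \<le> ereal (awalk_cost (\<lambda>_. 1) [])"
      unfolding graph_dist_def by (rule min_cost_le_walk_cost)
    moreover have "0 \<le> graph_dist G u u"
      unfolding graph_dist_def \<mu>_def by (rule INF_greatest) (simp add: cost)
    ultimately show "graph_dist G u v = 0" using \<open>u = v\<close> by (simp add: zero_ereal_def)
  next
    assume d: "graph_dist G u v = 0"
    show "u = v"
    proof (rule ccontr)
      assume "u \<noteq> v"
      have "1 \<le> graph_dist G u v"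
        unfolding graph_dist_def \<mu>_def
      proof (rule INF_greatest)
        fix p assume "p \<in> {p. awalk u p v}"
        then have "p \<noteq> []" using \<open>u \<noteq> v\<close> by (auto simp: awalk_Nil_iff)
        then have "1 \<le> real (length p)" by (cases p) auto
        then show "1 \<le> ereal (awalk_cost (\<lambda>_. 1) p)" by (simp add: cost one_ereal_def)
      qed
      with d show False by simp
    qed
  qed
qed

lemma resolving_set_pverts:
  assumes "pair_graph G"
  shows "resolving_set G (pverts G)"
  unfolding resolving_set_def resolves_def by (metis assms graph_dist_eq_0_iff order_refl)

lemma spanning_refl:
  assumes "pair_graph G"
  shows "spanning (with_proj G) (with_proj G)"
proof -
  interpret pair_graph G by fact
  show ?thesis using subgraph_refl by (simp add: spanning_def)
qed

lemma pair_graph_petersen: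
  assumes "1 \<le> k" "k < n"
  shows "pair_graph (petersen n k)"
proof -
  have n: "n > 1" using assms by simp
  have shift: "(i + j) mod n \<noteq> i" if "i < n" "1 \<le> j" "j < n" for i j
    using that by (cases "i + j < n") (auto simp: mod_if)
  have arcs: "x \<in> pverts (petersen n k) \<and> y \<in> pverts (petersen n k) \<and> x \<noteq> y"
    if "(x, y) \<in> petersen_arcs n k" for x y
    using that n assms shift[of _ k] shift[of _ 1]
    by (auto simp: petersen_arcs_def petersen_def) metis+
  have fin: "finite (petersen_arcs n k)" by (simp add: petersen_arcs_def)
  have "parcs (petersen n k) = petersen_arcs n k \<union> (petersen_arcs n k)\<inverse>"
    and "finite (pverts (petersen n k))"
    by (simp_all add: petersen_def)
  with arcs fin show ?thesis
    by unfold_locales (fastforce simp: symmetric_def sym_def)+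
qed

end

theory Submission
  imports Defs
begin

text \<open>
  Let \<open>H\<close> contain \<open>P(n,2)\<close> as a spanning subgraph, and suppose that \<open>a\<close> and \<open>b\<close> resolve \<open>H\<close>. Mapping a
  vertex to its two distances in \<open>H\<close> is injective, and by the triangle inequality a vertex at distance
  \<open>d\<close> from \<open>a\<close> is mapped to one of \<open>2d + 1\<close> points; so at most \<open>1 + 3 + 5 = 9\<close> vertices are within
  distance \<open>2\<close> of \<open>a\<close> in \<open>H\<close>. But a ball of radius \<open>2\<close> in \<open>P(n,2)\<close> has \<open>10\<close> vertices, except
  around \<open>u\<^sub>i\<close> for \<open>n = 6\<close> and \<open>n = 8\<close>, where a finer count with both landmarks gives a contradiction.
  Hence every such \<open>H\<close>, in particular \<open>P(n,2)\<close>, has metric dimension at least \<open>3\<close>.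

  Conversely \<open>P(n,2)\<close> is resolved by \<open>u\<^sub>0, u\<^sub>1, u\<^sub>2\<close> for \<open>n\<close> even, by \<open>u\<^sub>0, u\<^sub>1, v\<^bsub>m-1\<^esub>\<close> for
  \<open>n = 2m + 1 \<ge> 7\<close>, and by \<open>u\<^sub>0, u\<^sub>1, v\<^sub>2\<close> for \<open>n = 5\<close>.
\<close>

section \<open>Distances and walks\<close>

text \<open>With unit weights only the number of arcs of a walk matters; keeping it as a parameter
  allows induction on it.\<close>

definition has_walk :: "'a pair_pre_digraph \<Rightarrow> 'a \<Rightarrow> 'a \<Rightarrow> nat \<Rightarrow> bool" where
  "has_walk G u v k \<longleftrightarrow> (\<exists>p. pre_digraph.awalk (with_proj G) u p v \<and> length p = k)"

lemma graph_dist_eq_INF: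
  assumes "pair_graph G"
  shows "graph_dist G u v = (INF k\<in>{k. has_walk G u v k}. ereal (real k))"
proof -
  interpret pair_graph G by fact
  have "awalk_cost (\<lambda>_. 1) p = real (length p)" for p :: "('a \<times> 'a) list"
    by (induction p) auto
  moreover have "{k. has_walk G u v k} = length ` {p. awalk u p v}"
    by (auto simp: has_walk_def)
  ultimately show ?thesis
    by (simp add: graph_dist_def \<mu>_def image_image)
qed

lemma graph_dist_le:
  assumes "pair_graph G" "has_walk G u v k"
  shows "graph_dist G u v \<le> ereal (real k)"
  using assms by (auto simp: graph_dist_eq_INF intro: INF_lower)

text \<open>A nonempty set of natural numbers has a least element, so the infimum in
  \<open>ereal\<close> is attained once some walk exists. This is what permits natural-number
  distances later.\<close>

lemma graph_dist_attained:
  assumes "pair_graph G" "has_walk G u v m"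
  obtains k where "has_walk G u v k" "graph_dist G u v = ereal (real k)"
proof
  let ?k = "LEAST k. has_walk G u v k"
  show walk: "has_walk G u v ?k" using assms(2) by (rule LeastI)
  have "ereal (real ?k) \<le> graph_dist G u v"
    unfolding graph_dist_eq_INF[OF assms(1)] by (rule INF_greatest) (auto intro: Least_le)
  with graph_dist_le[OF assms(1) walk] show "graph_dist G u v = ereal (real ?k)" by simp
qed

context
  fixes G :: "'a pair_pre_digraph"
  assumes G: "pair_graph G"
begin

interpretation pair_graph G by (rule G)

lemma has_walk_0_iff: "has_walk G u v 0 \<longleftrightarrow> u = v \<and> u \<in> pverts G"
  by (auto simp: has_walk_def awalk_Nil_iff)

lemma has_walk_Suc_iff:
  "has_walk G u v (Suc k) \<longleftrightarrow> (\<exists>w. (u, w) \<in> parcs G \<and> has_walk G w v k)"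
proof
  assume "has_walk G u v (Suc k)"
  then show "\<exists>w. (u, w) \<in> parcs G \<and> has_walk G w v k"
    by (force simp: has_walk_def length_Suc_conv awalk_Cons_iff)
next
  assume "\<exists>w. (u, w) \<in> parcs G \<and> has_walk G w v k"
  then obtain w p where w: "(u, w) \<in> parcs G" "awalk w p v" "length p = k"
    by (auto simp: has_walk_def)
  then have "awalk u ((u, w) # p) v" by (simp add: awalk_Cons_iff)
  then show "has_walk G u v (Suc k)" unfolding has_walk_def using w(3) by (intro exI[of _ "(u, w) # p"]) simp
qed

lemma has_walk_trans:
  "has_walk G u v k \<Longrightarrow> has_walk G v w l \<Longrightarrow> has_walk G u w (k + l)"
  by (induction k arbitrary: u) (auto simp: has_walk_0_iff has_walk_Suc_iff)

lemma has_walk_sym: "has_walk G u v k \<Longrightarrow> has_walk G v u k"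
proof (induction k arbitrary: u)
  case (Suc k)
  then obtain w where w: "(u, w) \<in> parcs G" "has_walk G v w k" by (auto simp: has_walk_Suc_iff)
  then have "(w, u) \<in> parcs G" "u \<in> pverts G" by (auto simp: arcs_symmetric dest: in_arcsD1)
  then have "has_walk G w u (Suc 0)" by (auto simp: has_walk_Suc_iff has_walk_0_iff)
  then show ?case using has_walk_trans[OF w(2), of u "Suc 0"] by simp
qed (auto simp: has_walk_0_iff)

text \<open>A certificate for distances: by the Lipschitz condition no walk from \<open>u\<close> to
  \<open>w\<close> is shorter than \<open>f u\<close>, and following descents produces a walk of
  exactly that length.\<close>

lemma graph_dist_eqI:
  fixes f :: "'a \<Rightarrow> nat"
  assumes w: "w \<in> pverts G"
    and lipschitz: "\<And>x y. (x, y) \<in> parcs G \<Longrightarrow> f x \<le> Suc (f y)"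
    and descent: "\<And>x. x \<in> pverts G \<Longrightarrow> x \<noteq> w \<Longrightarrow> \<exists>y. (x, y) \<in> parcs G \<and> f y < f x"
    and "f w = 0" and u: "u \<in> pverts G"
  shows "graph_dist G u w = ereal (real (f u))"
proof (rule antisym)
  have "has_walk G u w (f u)" using u
  proof (induction "f u" arbitrary: u rule: less_induct)
    case less
    show ?case
    proof (cases "u = w")
      case True
      then show ?thesis using less \<open>f w = 0\<close> by (simp add: has_walk_0_iff)
    next
      case False
      with descent less.prems obtain y where y: "(u, y) \<in> parcs G" "f y < f u" by blast
      \<comment> \<open>\<open>descent\<close> only makes \<open>f\<close> smaller; with
        \<open>lipschitz\<close> the drop is exactly one, so the length of the walk comes out
        right.\<close>
      then have "f u = Suc (f y)" using lipschitz[OF y(1)] by simp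
      moreover have "y \<in> pverts G" using y(1) by (auto dest: in_arcsD2)
      ultimately show ?thesis using less.hyps[of y] y by (auto simp: has_walk_Suc_iff)
    qed
  qed
  then show "graph_dist G u w \<le> ereal (real (f u))" by (rule graph_dist_le[OF G])
  have "f v \<le> k" if "has_walk G v w k" for v k
    using that
  proof (induction k arbitrary: v)
    case (Suc k)
    then obtain y where y: "(v, y) \<in> parcs G" "has_walk G y w k" by (auto simp: has_walk_Suc_iff)
    from lipschitz[OF y(1)] Suc.IH[OF y(2)] show ?case by simp
  qed (simp add: has_walk_0_iff \<open>f w = 0\<close>)
  then show "ereal (real (f u)) \<le> graph_dist G u w"
    unfolding graph_dist_eq_INF[OF G] by (intro INF_greatest) auto
qed

end

lemma has_walk_mono:
  assumes "has_walk G u v k" "pair_graph G" "pair_graph H"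
    and "pverts G \<subseteq> pverts H" "parcs G \<subseteq> parcs H"
  shows "has_walk H u v k"
  using assms(1)
proof (induction k arbitrary: u)
  case 0
  then show ?case using assms by (auto simp: has_walk_0_iff)
next
  case (Suc k)
  then show ?case using assms by (auto simp: has_walk_Suc_iff)
qed

section \<open>Rotations of generalized Petersen graphs\<close>

fun rotate_vertex :: "nat \<Rightarrow> nat \<Rightarrow> petersen_vertex \<Rightarrow> petersen_vertex" where
  "rotate_vertex n c (Inner i) = Inner ((i + c) mod n)"
| "rotate_vertex n c (Outer i) = Outer ((i + c) mod n)"

lemma pverts_petersen: "pverts (petersen n k) = Inner ` {..<n} \<union> Outer ` {..<n}"
  by (simp add: petersen_def)

lemma parcs_petersen: "parcs (petersen n k) = petersen_arcs n k \<union> (petersen_arcs n k)\<inverse>"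
  by (simp add: petersen_def)

lemma Inner_in_pverts [simp]: "Inner i \<in> pverts (petersen n k) \<longleftrightarrow> i < n"
  and Outer_in_pverts [simp]: "Outer i \<in> pverts (petersen n k) \<longleftrightarrow> i < n"
  by (auto simp: pverts_petersen)

lemma card_pverts_petersen: "card (pverts (petersen n k)) = 2 * n"
proof -
  have "card (Inner ` {..<n} \<union> Outer ` {..<n}) = card (Inner ` {..<n}) + card (Outer ` {..<n})"
    by (rule card_Un_disjoint) auto
  then show ?thesis by (simp add: pverts_petersen card_image inj_on_def)
qed

lemma petersen_arcE:
  assumes "(x, y) \<in> petersen_arcs n k"
  obtains i where "i < n" "x = Outer i" "y = Outer ((i + 1) mod n)"
    | i where "i < n" "x = Inner i" "y = Outer i"
    | i where "i < n" "x = Inner i" "y = Inner ((i + k) mod n)"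
proof -
  from assms obtain i where "i < n" and "(x, y) \<in> {(Outer i, Outer ((i + 1) mod n)),
      (Inner i, Outer i), (Inner i, Inner ((i + k) mod n))}"
    unfolding petersen_arcs_def by (elim UN_E) simp
  with that[of i] show ?thesis by (elim insertE emptyE) simp_all
qed

lemma petersen_arcI:
  assumes "i < n"
  shows "(Outer i, Outer ((i + 1) mod n)) \<in> parcs (petersen n k)"
    and "(Outer ((i + 1) mod n), Outer i) \<in> parcs (petersen n k)"
    and "(Inner i, Outer i) \<in> parcs (petersen n k)"
    and "(Outer i, Inner i) \<in> parcs (petersen n k)"
    and "(Inner i, Inner ((i + k) mod n)) \<in> parcs (petersen n k)"
    and "(Inner ((i + k) mod n), Inner i) \<in> parcs (petersen n k)"
proof -
  have "{(Outer i, Outer ((i + 1) mod n)), (Inner i, Outer i), (Inner i, Inner ((i + k) mod n))}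
      \<subseteq> petersen_arcs n k"
    unfolding petersen_arcs_def using assms by (intro UN_upper) simp
  then show "(Outer i, Outer ((i + 1) mod n)) \<in> parcs (petersen n k)"
    and "(Outer ((i + 1) mod n), Outer i) \<in> parcs (petersen n k)"
    and "(Inner i, Outer i) \<in> parcs (petersen n k)"
    and "(Outer i, Inner i) \<in> parcs (petersen n k)"
    and "(Inner i, Inner ((i + k) mod n)) \<in> parcs (petersen n k)"
    and "(Inner ((i + k) mod n), Inner i) \<in> parcs (petersen n k)"
    by (simp_all add: parcs_petersen)
qed

lemma rotate_vertex_arc:
  assumes "(x, y) \<in> parcs (petersen n k)"
  shows "(rotate_vertex n c x, rotate_vertex n c y) \<in> parcs (petersen n k)"
proof -
  have *: "(rotate_vertex n c x, rotate_vertex n c y) \<in> petersen_arcs n k"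
    if xy: "(x, y) \<in> petersen_arcs n k" for x y
  proof -
    have shift: "((i + l) mod n + c) mod n = ((i + c) mod n + l) mod n" for i l
      by (simp add: mod_simps ac_simps)
    from xy show ?thesis
    proof (cases rule: petersen_arcE)
      case (1 i)
      then show ?thesis using shift[of i 1] by (auto simp: petersen_arcs_def)
    next
      case (2 i)
      then show ?thesis by (auto simp: petersen_arcs_def)
    next
      case (3 i)
      then show ?thesis using shift[of i k] by (auto simp: petersen_arcs_def)
    qed
  qed
  then show ?thesis using assms by (auto simp: parcs_petersen)
qed

lemma rotate_vertex_in_pverts:
  "x \<in> pverts (petersen n k) \<Longrightarrow> rotate_vertex n c x \<in> pverts (petersen n k)"
  by (cases x) auto

text \<open>\<open>n - c\<close> stands for \<open>-c\<close> modulo \<open>n\<close>;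
  \<open>c \<le> n\<close> keeps the truncated subtraction exact.\<close>

lemma rotate_vertex_inverse:
  assumes "x \<in> pverts (petersen n k)" "c \<le> n"
  shows "rotate_vertex n c (rotate_vertex n (n - c) x) = x"
    and "rotate_vertex n (n - c) (rotate_vertex n c x) = x"
proof -
  have shift: "((i + d) mod n + e) mod n = i" if "i < n" "d + e = n" for i d e
  proof -
    have "((i + d) mod n + e) mod n = (i + (d + e)) mod n" by (simp add: mod_add_left_eq add.assoc)
    then show ?thesis using that by simp
  qed
  have c: "(n - c) + c = n" "c + (n - c) = n" using assms(2) by simp_all
  show "rotate_vertex n c (rotate_vertex n (n - c) x) = x"
    and "rotate_vertex n (n - c) (rotate_vertex n c x) = x"
    using assms(1) shift[OF _ c(1)] shift[OF _ c(2)] by (cases x; simp only: rotate_vertex.simps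
        Inner_in_pverts Outer_in_pverts)+
qed

text \<open>Rotations are automorphisms, so a distance certificate for \<open>w\<close> serves all
  its rotated copies, with \<open>f\<close> evaluated after rotating back. The Lipschitz condition
  is split into the three families of arcs, each taken in both directions.\<close>

lemma petersen_dist_eqI:
  fixes f :: "petersen_vertex \<Rightarrow> nat"
  assumes G: "pair_graph (petersen n k)"
    and w: "w \<in> pverts (petersen n k)" and "f w = 0"
    and outer: "\<And>i. i < n \<Longrightarrow> f (Outer i) \<le> Suc (f (Outer ((i + 1) mod n))) \<and> f (Outer ((i + 1) mod n)) \<le> Suc (f (Outer i))"
    and spoke: "\<And>i. i < n \<Longrightarrow> f (Outer i) \<le> Suc (f (Inner i)) \<and> f (Inner i) \<le> Suc (f (Outer i))"
    and inner: "\<And>i. i < n \<Longrightarrow> f (Inner i) \<le> Suc (f (Inner ((i + k) mod n))) \<and> f (Inner ((i + k) mod n)) \<le> Suc (f (Inner i))"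
    and descent: "\<And>x. x \<in> pverts (petersen n k) \<Longrightarrow> x \<noteq> w \<Longrightarrow> \<exists>y. (x, y) \<in> parcs (petersen n k) \<and> f y < f x"
    and x: "x \<in> pverts (petersen n k)" and c: "c \<le> n"
  shows "graph_dist (petersen n k) x (rotate_vertex n c w) = ereal (real (f (rotate_vertex n (n - c) x)))"
proof (rule graph_dist_eqI[OF G, where f = "\<lambda>x. f (rotate_vertex n (n - c) x)"])
  have lipschitz: "f x \<le> Suc (f y)" if xy: "(x, y) \<in> parcs (petersen n k)" for x y
  proof -
    have "f x \<le> Suc (f y) \<and> f y \<le> Suc (f x)" if "(x, y) \<in> petersen_arcs n k" for x y
      using that
    proof (cases rule: petersen_arcE)
      case (1 i)
      then show ?thesis using outer[of i] by simp
    next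
      case (2 i)
      then show ?thesis using spoke[of i] by simp
    next
      case (3 i)
      then show ?thesis using inner[of i] by simp
    qed
    then show ?thesis using xy by (auto simp: parcs_petersen)
  qed
  show "f (rotate_vertex n (n - c) x) \<le> Suc (f (rotate_vertex n (n - c) y))"
    if "(x, y) \<in> parcs (petersen n k)" for x y
    using that by (intro lipschitz rotate_vertex_arc)
  show "\<exists>y. (x, y) \<in> parcs (petersen n k) \<and> f (rotate_vertex n (n - c) y) < f (rotate_vertex n (n - c) x)"
    if x: "x \<in> pverts (petersen n k)" "x \<noteq> rotate_vertex n c w" for x
  proof -
    have "rotate_vertex n (n - c) x \<noteq> w" using x c rotate_vertex_inverse(1) by metis
    then obtain y where y: "(rotate_vertex n (n - c) x, y) \<in> parcs (petersen n k)"
      "f y < f (rotate_vertex n (n - c) x)"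
      using descent rotate_vertex_in_pverts x(1) by meson
    interpret pair_graph "petersen n k" by (rule G)
    have "y \<in> pverts (petersen n k)" using y(1) by (rule in_arcsD2)
    then have "f (rotate_vertex n (n - c) (rotate_vertex n c y)) < f (rotate_vertex n (n - c) x)"
      using y(2) c by (simp add: rotate_vertex_inverse)
    moreover have "(x, rotate_vertex n c y) \<in> parcs (petersen n k)"
      using rotate_vertex_arc[OF y(1), of c] rotate_vertex_inverse(1)[OF x(1) c] by simp
    ultimately show ?thesis by blast
  qed
  show "rotate_vertex n c w \<in> pverts (petersen n k)" using w by (rule rotate_vertex_in_pverts)
  show "f (rotate_vertex n (n - c) (rotate_vertex n c w)) = 0"
    using w c \<open>f w = 0\<close> by (simp add: rotate_vertex_inverse)
qed (rule x)

section \<open>Distance formulas in \<open>P(n,2)\<close>\<close>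

text \<open>
  The least number of edges needed to advance the index by \<open>j\<close> in one direction, from \<open>u\<close> to \<open>u\<close>,
  between \<open>u\<close> and \<open>v\<close>, and from \<open>v\<close> to \<open>v\<close>. Distances are minima over the two directions.
\<close>

definition inner_span :: "nat \<Rightarrow> nat" where
  "inner_span j = j div 2 + (if even j then 0 else 3)"

definition mixed_span :: "nat \<Rightarrow> nat" where
  "mixed_span j = (j + 3) div 2"

definition outer_span :: "nat \<Rightarrow> nat" where
  "outer_span j = min j ((j + 5) div 2)"

fun inner_dist :: "nat \<Rightarrow> petersen_vertex \<Rightarrow> nat" where
  "inner_dist n (Inner i) = min (inner_span i) (inner_span (n - i))"
| "inner_dist n (Outer i) = min (mixed_span i) (mixed_span (n - i))"

fun outer_dist :: "nat \<Rightarrow> petersen_vertex \<Rightarrow> nat" where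
  "outer_dist n (Inner i) = min (mixed_span i) (mixed_span (n - i))"
| "outer_dist n (Outer i) = min (outer_span i) (outer_span (n - i))"

lemma span_step:
  "inner_span (j + 2) = Suc (inner_span j)"
  "mixed_span (j + 2) = Suc (mixed_span j)"
  "mixed_span j \<le> mixed_span (Suc j)" "mixed_span (Suc j) \<le> Suc (mixed_span j)"
  "outer_span j \<le> outer_span (Suc j)" "outer_span (Suc j) \<le> Suc (outer_span j)"
  "inner_span j \<le> Suc (mixed_span j)" "mixed_span j \<le> Suc (inner_span j)"
  "outer_span j \<le> Suc (mixed_span j)" "mixed_span j \<le> Suc (outer_span j)"
proof -
  obtain t where "j = 2 * t \<or> j = Suc (2 * t)" by (metis oddE evenE Suc_eq_plus1)
  then show "inner_span (j + 2) = Suc (inner_span j)"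
    "mixed_span (j + 2) = Suc (mixed_span j)"
    "mixed_span j \<le> mixed_span (Suc j)" "mixed_span (Suc j) \<le> Suc (mixed_span j)"
    "outer_span j \<le> outer_span (Suc j)" "outer_span (Suc j) \<le> Suc (outer_span j)"
    "inner_span j \<le> Suc (mixed_span j)" "mixed_span j \<le> Suc (inner_span j)"
    "outer_span j \<le> Suc (mixed_span j)" "mixed_span j \<le> Suc (outer_span j)"
    unfolding inner_span_def mixed_span_def outer_span_def by auto
qed

text \<open>The delicate case is \<open>i + 1 = n\<close>: the new index is 0, where the minimum is
  \<open>F 0\<close> by monotonicity.\<close>

lemma cyclic_step_1:
  fixes F :: "nat \<Rightarrow> nat"
  assumes step: "\<And>j. F j \<le> F (Suc j) \<and> F (Suc j) \<le> Suc (F j)" and "i < n"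
  shows "min (F i) (F (n - i)) \<le> Suc (min (F ((i + 1) mod n)) (F (n - (i + 1) mod n)))"
    and "min (F ((i + 1) mod n)) (F (n - (i + 1) mod n)) \<le> Suc (min (F i) (F (n - i)))"
proof -
  obtain e where n: "n = i + Suc e" using \<open>i < n\<close> less_iff_Suc_add by auto
  have mono: "F 0 \<le> F j" for j by (induction j) (use step order_trans in blast)+
  show "min (F i) (F (n - i)) \<le> Suc (min (F ((i + 1) mod n)) (F (n - (i + 1) mod n)))"
    and "min (F ((i + 1) mod n)) (F (n - (i + 1) mod n)) \<le> Suc (min (F i) (F (n - i)))"
    using step[of i] step[of e] mono[of i] mono[of "Suc i"]
    by (cases e; auto simp: n min_def)+
qed

text \<open>\<open>inner_span\<close> is not monotone (\<open>inner_span 1 = 3\<close>,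
  \<open>inner_span 2 = 1\<close>), so, unlike in \<open>cyclic_step_1\<close>, the order assumption
  says only that \<open>F 0\<close> is the smallest value.\<close>

lemma cyclic_step_2:
  fixes F :: "nat \<Rightarrow> nat"
  assumes step: "\<And>j. F (j + 2) = Suc (F j)" and mono: "\<And>j. F 0 \<le> F j" and n: "i < n" "n \<ge> 3"
  shows "min (F i) (F (n - i)) \<le> Suc (min (F ((i + 2) mod n)) (F (n - (i + 2) mod n)))"
    and "min (F ((i + 2) mod n)) (F (n - (i + 2) mod n)) \<le> Suc (min (F i) (F (n - i)))"
proof -
  consider "i + 2 < n" | "n = i + 2" | "n = i + 1" using n by linarith
  then have "min (F i) (F (n - i)) \<le> Suc (min (F ((i + 2) mod n)) (F (n - (i + 2) mod n)))
    \<and> min (F ((i + 2) mod n)) (F (n - (i + 2) mod n)) \<le> Suc (min (F i) (F (n - i)))"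
  proof cases
    case 1
    then obtain e where e: "n = i + 2 + e" by (metis le_iff_add less_imp_le_nat)
    with 1 step[of i] step[of e] show ?thesis by (auto simp: min_def)
  next
    case 2
    then have "(i + 2) mod n = 0" "F n = Suc (F i)" "n - i = 2" "F 2 = Suc (F 0)"
      using step[of i] step[of 0] by (simp_all add: numeral_2_eq_2)
    then show ?thesis using mono[of i] by (auto simp: min_def)
  next
    case 3
    \<comment> \<open>The step jumps over index 0, from \<open>n - 1\<close> to 1. Reversing the
      direction exchanges these two indices, so both minima are equal.\<close>
    then have "(i + 2) mod n = 1" using n by (simp add: mod_if)
    with 3 show ?thesis by (auto simp: min_def)
  qed
  then show "min (F i) (F (n - i)) \<le> Suc (min (F ((i + 2) mod n)) (F (n - (i + 2) mod n)))"
    and "min (F ((i + 2) mod n)) (F (n - (i + 2) mod n)) \<le> Suc (min (F i) (F (n - i)))" by auto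
qed

lemma span_0_le:
  "inner_span 0 \<le> inner_span j" "mixed_span 0 \<le> mixed_span j"
  unfolding inner_span_def mixed_span_def by auto

lemma span_back:
  assumes "2 \<le> j"
  shows "inner_span j = Suc (inner_span (j - 2))" "mixed_span j = Suc (mixed_span (j - 2))"
  using span_step(1,2)[of "j - 2"] assms by (simp_all only: le_add_diff_inverse2)

lemma petersen_arc_back:
  assumes "k \<le> i" "i < n"
  shows "(Inner i, Inner (i - k)) \<in> parcs (petersen n k)"
  using petersen_arcI(6)[of "i - k" n k] assms by simp

lemma petersen_arc_outer_back:
  assumes "1 \<le> i" "i < n"
  shows "(Outer i, Outer (i - 1)) \<in> parcs (petersen n k)"
  using petersen_arcI(2)[of "i - 1" n k] assms by simp

text \<open>The next vertex depends on the direction that attains the minimum and on the parity of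
  the gap in that direction. An inner vertex with an even gap moves two indices closer, one with an
  odd gap leaves along its spoke; an outer vertex with an odd gap moves one index along the rim, one
  with an even gap enters along its spoke.\<close>

lemma inner_dist_descent:
  assumes n: "n \<ge> 5" and x: "x \<in> pverts (petersen n 2)" "x \<noteq> Inner 0"
  shows "\<exists>y. (x, y) \<in> parcs (petersen n 2) \<and> inner_dist n y < inner_dist n x"
proof (cases x)
  case (Inner i)
  then have i: "0 < i" "i < n" using x by auto
  consider (odd) "odd i" "inner_span i \<le> inner_span (n - i)"
    | (even) "even i" "inner_span i \<le> inner_span (n - i)"
    | (odd') "odd (n - i)" "inner_span (n - i) < inner_span i"
    | (even') "even (n - i)" "inner_span (n - i) < inner_span i" by linarith
  then show ?thesis
  proof cases
    case odd
    then have "mixed_span i < inner_span i" by (auto simp: mixed_span_def inner_span_def elim!: oddE)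
    with odd Inner i show ?thesis by (intro exI[of _ "Outer i"]) (simp add: petersen_arcI)
  next
    case odd'
    then have "mixed_span (n - i) < inner_span (n - i)"
      by (auto simp: mixed_span_def inner_span_def elim!: oddE)
    with odd' Inner i show ?thesis by (intro exI[of _ "Outer i"]) (simp add: petersen_arcI)
  next
    case even
    then have "2 \<le> i" using i by (auto elim!: evenE)
    then have "inner_span i = Suc (inner_span (i - 2))" by (rule span_back)
    with even Inner i \<open>2 \<le> i\<close> show ?thesis
      by (intro exI[of _ "Inner (i - 2)"]) (simp add: petersen_arc_back)
  next
    case even'
    have "n - i \<noteq> 1" using even'(1) by (metis odd_one)
    then have "2 \<le> n - i" using i by linarith
    then have step: "inner_span (n - i) = Suc (inner_span (n - (i + 2)))"
      using span_back(1)[of "n - i"] by simp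
    \<comment> \<open>For \<open>i + 2 = n\<close> the step ends at index 0, where the bound comes
      from the other argument of the minimum, \<open>inner_span 0\<close>.\<close>
    have "inner_dist n (Inner ((i + 2) mod n)) < inner_span (n - i)"
    proof (cases "i + 2 < n")
      case True
      then show ?thesis using step by simp
    next
      case False
      then have "i + 2 = n" using \<open>2 \<le> n - i\<close> by simp
      then show ?thesis using step by simp
    qed
    with even' Inner i show ?thesis
      by (intro exI[of _ "Inner ((i + 2) mod n)"]) (use petersen_arcI(5)[of i n 2] in simp)
  qed
next
  case (Outer i)
  then have i: "i < n" using x by auto
  have pred: "mixed_span (j - 1) < mixed_span j" if "odd j" for j
    using that by (auto simp: mixed_span_def elim!: oddE)
  consider (odd) "odd i" "mixed_span i \<le> mixed_span (n - i)"
    | (even) "even i" "mixed_span i \<le> mixed_span (n - i)"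
    | (odd') "odd (n - i)" "mixed_span (n - i) < mixed_span i"
    | (even') "even (n - i)" "mixed_span (n - i) < mixed_span i" by linarith
  then show ?thesis
  proof cases
    case even
    then have "inner_span i < mixed_span i" by (auto simp: mixed_span_def inner_span_def elim!: evenE)
    with even Outer i show ?thesis by (intro exI[of _ "Inner i"]) (simp add: petersen_arcI)
  next
    case even'
    then have "inner_span (n - i) < mixed_span (n - i)"
      by (auto simp: mixed_span_def inner_span_def elim!: evenE)
    with even' Outer i show ?thesis by (intro exI[of _ "Inner i"]) (simp add: petersen_arcI)
  next
    case odd
    then have "mixed_span (i - 1) < mixed_span i" by (intro pred)
    moreover have "1 \<le> i" using odd by (auto elim!: oddE)
    ultimately show ?thesis using odd Outer i
      by (intro exI[of _ "Outer (i - 1)"]) (simp add: petersen_arc_outer_back[simplified])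
  next
    case odd'
    then have step: "mixed_span (n - (i + 1)) < mixed_span (n - i)"
      using pred[of "n - i"] by simp
    have "inner_dist n (Outer ((i + 1) mod n)) < mixed_span (n - i)"
      using step i by (cases "i + 1 < n") (auto simp: not_less le_Suc_eq)
    with odd' Outer i show ?thesis
      by (intro exI[of _ "Outer ((i + 1) mod n)"])
        (use petersen_arcI(1)[of i n 2] in simp)
  qed
qed

text \<open>Between outer vertices the rim is followed while the gap is below 4; from 4 on, entering
  along the spoke is already a descent, which fixes the threshold. An inner vertex goes out only at
  gap 0 or 1 and otherwise moves two indices closer.\<close>

lemma outer_dist_descent:
  assumes n: "n \<ge> 5" and x: "x \<in> pverts (petersen n 2)" "x \<noteq> Outer 0"
  shows "\<exists>y. (x, y) \<in> parcs (petersen n 2) \<and> outer_dist n y < outer_dist n x"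
proof (cases x)
  case (Inner i)
  then have i: "i < n" using x by auto
  have small: "outer_span j < mixed_span j" if "j < 2" for j
    using that by (auto simp: outer_span_def mixed_span_def less_2_cases_iff)
  consider (near) "i < 2" "mixed_span i \<le> mixed_span (n - i)"
    | (far) "2 \<le> i" "mixed_span i \<le> mixed_span (n - i)"
    | (near') "n - i < 2" "mixed_span (n - i) < mixed_span i"
    | (far') "2 \<le> n - i" "mixed_span (n - i) < mixed_span i" by linarith
  then show ?thesis
  proof cases
    case near
    with small[of i] Inner i show ?thesis by (intro exI[of _ "Outer i"]) (simp add: petersen_arcI)
  next
    case near'
    with small[of "n - i"] Inner i show ?thesis
      by (intro exI[of _ "Outer i"]) (simp add: petersen_arcI)
  next
    case far
    then have "mixed_span i = Suc (mixed_span (i - 2))" by (intro span_back)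
    with far Inner i show ?thesis
      by (intro exI[of _ "Inner (i - 2)"]) (simp add: petersen_arc_back)
  next
    case far'
    then have step: "mixed_span (n - i) = Suc (mixed_span (n - (i + 2)))"
      using span_back(2)[of "n - i"] by simp
    have "outer_dist n (Inner ((i + 2) mod n)) < mixed_span (n - i)"
    proof (cases "i + 2 < n")
      case True
      then show ?thesis using step by simp
    next
      case False
      then have "i + 2 = n" using far' by simp
      then show ?thesis using step by simp
    qed
    with far' Inner i show ?thesis
      by (intro exI[of _ "Inner ((i + 2) mod n)"]) (use petersen_arcI(5)[of i n 2] in simp)
  qed
next
  case (Outer i)
  then have i: "0 < i" "i < n" using x by auto
  have big: "mixed_span j < outer_span j" if "4 \<le> j" for j
    using that by (auto simp: outer_span_def mixed_span_def)
  have small: "outer_span (j - 1) < outer_span j" if "0 < j" "j < 4" for j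
    using that by (auto simp: outer_span_def)
  consider (near) "i < 4" "outer_span i \<le> outer_span (n - i)"
    | (far) "4 \<le> i" "outer_span i \<le> outer_span (n - i)"
    | (near') "n - i < 4" "outer_span (n - i) < outer_span i"
    | (far') "4 \<le> n - i" "outer_span (n - i) < outer_span i" by linarith
  then show ?thesis
  proof cases
    case far
    with big[of i] Outer i show ?thesis by (intro exI[of _ "Inner i"]) (simp add: petersen_arcI)
  next
    case far'
    with big[of "n - i"] Outer i show ?thesis
      by (intro exI[of _ "Inner i"]) (simp add: petersen_arcI)
  next
    case near
    with small[of i] Outer i show ?thesis
      by (intro exI[of _ "Outer (i - 1)"]) (simp add: petersen_arc_outer_back[simplified])
  next
    case near'
    then have step: "outer_span (n - (i + 1)) < outer_span (n - i)"
      using small[of "n - i"] i by simp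
    have "outer_dist n (Outer ((i + 1) mod n)) < outer_span (n - i)"
      using step i by (cases "i + 1 < n") (auto simp: not_less le_Suc_eq)
    with near' Outer i show ?thesis
      by (intro exI[of _ "Outer ((i + 1) mod n)"])
        (use petersen_arcI(1)[of i n 2] in simp)
  qed
qed

lemma graph_dist_Inner:
  assumes "n \<ge> 5" "x \<in> pverts (petersen n 2)" "c < n"
  shows "graph_dist (petersen n 2) x (Inner c) = ereal (real (inner_dist n (rotate_vertex n (n - c) x)))"
proof -
  have "graph_dist (petersen n 2) x (rotate_vertex n c (Inner 0)) =
      ereal (real (inner_dist n (rotate_vertex n (n - c) x)))"
  proof (rule petersen_dist_eqI)
    show "pair_graph (petersen n 2)" by (rule pair_graph_petersen) (use assms in auto)
    fix i assume i: "i < n"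
    show "inner_dist n (Outer i) \<le> Suc (inner_dist n (Outer ((i + 1) mod n))) \<and>
        inner_dist n (Outer ((i + 1) mod n)) \<le> Suc (inner_dist n (Outer i))"
      unfolding inner_dist.simps using i by (intro conjI cyclic_step_1) (simp_all add: span_step)
    show "inner_dist n (Outer i) \<le> Suc (inner_dist n (Inner i)) \<and>
        inner_dist n (Inner i) \<le> Suc (inner_dist n (Outer i))"
      using span_step(7,8)[of i] span_step(7,8)[of "n - i"] by auto
    show "inner_dist n (Inner i) \<le> Suc (inner_dist n (Inner ((i + 2) mod n))) \<and>
        inner_dist n (Inner ((i + 2) mod n)) \<le> Suc (inner_dist n (Inner i))"
      unfolding inner_dist.simps using i assms(1)
      by (intro conjI cyclic_step_2 span_step(1) span_0_le) simp_all
  qed (use assms inner_dist_descent in \<open>auto simp: inner_span_def\<close>)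
  then show ?thesis using assms by simp
qed

lemma graph_dist_Outer:
  assumes "n \<ge> 5" "x \<in> pverts (petersen n 2)" "c < n"
  shows "graph_dist (petersen n 2) x (Outer c) = ereal (real (outer_dist n (rotate_vertex n (n - c) x)))"
proof -
  have "graph_dist (petersen n 2) x (rotate_vertex n c (Outer 0)) =
      ereal (real (outer_dist n (rotate_vertex n (n - c) x)))"
  proof (rule petersen_dist_eqI)
    show "pair_graph (petersen n 2)" by (rule pair_graph_petersen) (use assms in auto)
    fix i assume i: "i < n"
    show "outer_dist n (Outer i) \<le> Suc (outer_dist n (Outer ((i + 1) mod n))) \<and>
        outer_dist n (Outer ((i + 1) mod n)) \<le> Suc (outer_dist n (Outer i))"
      unfolding outer_dist.simps using i by (intro conjI cyclic_step_1) (simp_all add: span_step)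
    show "outer_dist n (Outer i) \<le> Suc (outer_dist n (Inner i)) \<and>
        outer_dist n (Inner i) \<le> Suc (outer_dist n (Outer i))"
      using span_step(9,10)[of i] span_step(9,10)[of "n - i"] by auto
    show "outer_dist n (Inner i) \<le> Suc (outer_dist n (Inner ((i + 2) mod n))) \<and>
        outer_dist n (Inner ((i + 2) mod n)) \<le> Suc (outer_dist n (Inner i))"
      unfolding outer_dist.simps using i assms(1)
      by (intro conjI cyclic_step_2 span_step(2) span_0_le) simp_all
  qed (use assms outer_dist_descent in \<open>auto simp: outer_span_def\<close>)
  then show ?thesis using assms by simp
qed

section \<open>Resolving sets of three vertices\<close>

text \<open>A minimum over both directions depends only on the absolute difference of the indices:
  for \<open>i < c\<close> the two directions merely trade places. This removes all modular
  arithmetic from the distance formulas.\<close>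

lemma cyclic_rotate:
  fixes F :: "nat \<Rightarrow> nat"
  assumes "c < n" "i < n"
  shows "min (F ((i + (n - c)) mod n)) (F (n - (i + (n - c)) mod n)) =
    (if c \<le> i then min (F (i - c)) (F (n - (i - c))) else min (F (c - i)) (F (n - (c - i))))"
proof (cases "c \<le> i")
  case True
  then have "i + (n - c) = n + (i - c)" using assms by simp
  then have "(i + (n - c)) mod n = i - c" using assms by (simp only: mod_add_self1) simp
  with True show ?thesis by simp
next
  case False
  then have "(i + (n - c)) mod n = n - (c - i)" and "n - (n - (c - i)) = c - i"
    using assms by simp_all
  with False show ?thesis by (simp only: min.commute if_False)
qed

definition from_inner :: "nat \<Rightarrow> nat \<Rightarrow> petersen_vertex \<Rightarrow> nat" where
  "from_inner n c x = inner_dist n (rotate_vertex n (n - c) x)"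

definition from_outer :: "nat \<Rightarrow> nat \<Rightarrow> petersen_vertex \<Rightarrow> nat" where
  "from_outer n c x = outer_dist n (rotate_vertex n (n - c) x)"

lemma from_inner_simps:
  assumes "c < n" "i < n"
  shows "from_inner n c (Inner i) =
      (if c \<le> i then min (inner_span (i - c)) (inner_span (n - (i - c)))
       else min (inner_span (c - i)) (inner_span (n - (c - i))))"
    and "from_inner n c (Outer i) =
      (if c \<le> i then min (mixed_span (i - c)) (mixed_span (n - (i - c)))
       else min (mixed_span (c - i)) (mixed_span (n - (c - i))))"
  using cyclic_rotate[OF assms] by (simp_all only: from_inner_def rotate_vertex.simps inner_dist.simps)

lemma from_outer_simps:
  assumes "c < n" "i < n"
  shows "from_outer n c (Inner i) =
      (if c \<le> i then min (mixed_span (i - c)) (mixed_span (n - (i - c)))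
       else min (mixed_span (c - i)) (mixed_span (n - (c - i))))"
    and "from_outer n c (Outer i) =
      (if c \<le> i then min (outer_span (i - c)) (outer_span (n - (i - c)))
       else min (outer_span (c - i)) (outer_span (n - (c - i))))"
  using cyclic_rotate[OF assms] by (simp_all only: from_outer_def rotate_vertex.simps outer_dist.simps)

lemma span_simps [simp]:
  "inner_span (2 * a) = a" "inner_span (Suc (2 * a)) = a + 3"
  "mixed_span (2 * a) = a + 1" "mixed_span (Suc (2 * a)) = a + 2"
  by (auto simp: inner_span_def mixed_span_def)

text \<open>Consecutive values may agree, for example at 5 and 6, hence the gap of two.\<close>

lemma outer_span_strict:
  assumes "i + 2 \<le> j"
  shows "outer_span i < outer_span j"
  using assms by (auto simp: outer_span_def)

lemma resolving_set_three:
  fixes f g h :: "'a \<Rightarrow> nat"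
  assumes "{a, b, c} \<subseteq> pverts G"
    and "\<And>x. x \<in> pverts G \<Longrightarrow> graph_dist G x a = ereal (real (f x))"
    and "\<And>x. x \<in> pverts G \<Longrightarrow> graph_dist G x b = ereal (real (g x))"
    and "\<And>x. x \<in> pverts G \<Longrightarrow> graph_dist G x c = ereal (real (h x))"
    and "inj_on (\<lambda>x. (f x, g x, h x)) (pverts G)"
  shows "resolving_set G {a, b, c}"
  using assms unfolding resolving_set_def resolves_def inj_on_def by force

section \<open>Even \<open>n\<close>: the landmarks \<open>Inner 0\<close>, \<open>Inner 1\<close>,
  \<open>Inner 2\<close>\<close>

lemma inner_distances_even:
  assumes "n = 2 * (a + r)" "1 \<le> r" "3 \<le> a + r"
  shows "from_inner n 0 (Inner (2 * a)) = min a r"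
    and "from_inner n (Suc 0) (Inner (2 * a)) = (if a = 0 then 3 else min (a + 2) (r + 3))"
    and "from_inner n 0 (Inner (Suc (2 * a))) = min (a + 3) (r + 2)"
    and "from_inner n (Suc 0) (Inner (Suc (2 * a))) = min a r"
    and "from_inner n 0 (Outer (2 * a)) = min (a + 1) (r + 1)"
    and "from_inner n (Suc 0) (Outer (2 * a)) = (if a = 0 then 2 else min (a + 1) (r + 2))"
    and "from_inner n 2 (Outer (2 * a)) = (if a = 0 then 2 else min a (r + 2))"
    and "from_inner n 0 (Outer (Suc (2 * a))) = min (a + 2) (r + 1)"
    and "from_inner n (Suc 0) (Outer (Suc (2 * a))) = min (a + 1) (r + 1)"
    and "from_inner n 2 (Outer (Suc (2 * a))) = (if a = 0 then 2 else min (a + 1) (r + 2))"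
proof -
  have lt: "0 < n" "Suc 0 < n" "2 < n" "2 * a < n" "Suc (2 * a) < n" using assms by auto
  \<comment> \<open>\<open>a\<close> and \<open>r\<close> count steps of two, from 0 to
    \<open>2 * a\<close> and from there on to \<open>n\<close>; in these variables every distance is
    piecewise linear. The gap left after the odd index \<open>2 * a + 1\<close> is
    \<open>2 * q + 1\<close> with \<open>q = r - 1\<close>.\<close>
  obtain q where q: "r = Suc q" using assms(2) by (cases r) auto
  note simps = from_inner_simps(1)[OF lt(1)] from_inner_simps(1)[OF lt(2)] from_inner_simps(1)[OF lt(3)]
     from_inner_simps(2)[OF lt(1)] from_inner_simps(2)[OF lt(2)] from_inner_simps(2)[OF lt(3)]
  have *: "n - Suc (2 * a) = Suc (2 * q)" "n - 2 * a = 2 * r" using assms q by auto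
  show "from_inner n 0 (Inner (2 * a)) = min a r"
    "from_inner n 0 (Inner (Suc (2 * a))) = min (a + 3) (r + 2)"
    "from_inner n (Suc 0) (Inner (Suc (2 * a))) = min a r"
    "from_inner n 0 (Outer (2 * a)) = min (a + 1) (r + 1)"
    "from_inner n 0 (Outer (Suc (2 * a))) = min (a + 2) (r + 1)"
    "from_inner n (Suc 0) (Outer (Suc (2 * a))) = min (a + 1) (r + 1)"
    by (simp_all add: simps lt *) (simp_all add: q)
  have n1: "n - Suc 0 = Suc (2 * (a + q))" "n - 2 = 2 * (a + q)" using assms q by auto
  have "from_inner n (Suc 0) (Inner (2 * a)) = (if a = 0 then 3 else min (a + 2) (r + 3)) \<and>
    from_inner n (Suc 0) (Outer (2 * a)) = (if a = 0 then 2 else min (a + 1) (r + 2)) \<and>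
    from_inner n 2 (Outer (2 * a)) = (if a = 0 then 2 else min a (r + 2)) \<and>
    from_inner n 2 (Outer (Suc (2 * a))) = (if a = 0 then 2 else min (a + 1) (r + 2))"
  \<comment> \<open>For \<open>a = 0\<close>, index 0 precedes the landmarks 1 and 2, and index 1
    precedes 2, so the other branch of \<open>from_inner_simps\<close> applies. This causes the
    special values in the statement.\<close>
  proof (cases a)
    case 0
    have s: "inner_span (Suc 0) = 3" "mixed_span (Suc 0) = 2" "mixed_span 2 = 2"
      by (simp_all add: inner_span_def mixed_span_def)
    show ?thesis
      using 0 assms(3) q lt n1 by (simp add: simps s)
  next
    case (Suc b)
    have d: "2 * a - Suc 0 = Suc (2 * b)" "2 * a - 2 = 2 * b" "Suc (2 * a) - 2 = Suc (2 * b)"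
      "n - Suc (2 * b) = Suc (2 * r)" "n - 2 * b = 2 * Suc r"
      and pos: "a \<noteq> 0" "Suc 0 \<le> 2 * a" "2 \<le> 2 * a" "2 \<le> Suc (2 * a)"
      using assms Suc by simp_all
    show ?thesis
      unfolding simps(2)[OF lt(4)] simps(5)[OF lt(4)] simps(6)[OF lt(4)] simps(6)[OF lt(5)]
      by (simp only: d pos span_simps if_True if_False) (simp add: Suc)
  qed
  then show "from_inner n (Suc 0) (Inner (2 * a)) = (if a = 0 then 3 else min (a + 2) (r + 3))"
    "from_inner n (Suc 0) (Outer (2 * a)) = (if a = 0 then 2 else min (a + 1) (r + 2))"
    "from_inner n 2 (Outer (2 * a)) = (if a = 0 then 2 else min a (r + 2))"
    "from_inner n 2 (Outer (Suc (2 * a))) = (if a = 0 then 2 else min (a + 1) (r + 2))" by blast+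
qed

text \<open>The distances to \<open>Inner 0\<close> and \<open>Inner 1\<close> differ by at least 2
  at an inner vertex, with the sign revealing its parity, and by at most 1 at an outer vertex. These
  two distances also separate inner vertices of equal parity; the third landmark is there for pairs
  of outer vertices.\<close>

lemma inner_distances_inj_even:
  assumes n: "n = 2 * m" "3 \<le> m"
  shows "inj_on (\<lambda>x. (from_inner n 0 x, from_inner n (Suc 0) x, from_inner n 2 x)) (pverts (petersen n k))"
proof (rule inj_onI)
  have split: "\<exists>a r. m = a + r \<and> 1 \<le> r \<and>
      (x = Inner (2 * a) \<or> x = Inner (Suc (2 * a)) \<or> x = Outer (2 * a) \<or> x = Outer (Suc (2 * a)))"
    if "x \<in> pverts (petersen n k)" for x
  proof -
    obtain i where i: "i < n" "x = Inner i \<or> x = Outer i" using \<open>x \<in> _\<close> by (auto simp: pverts_petersen)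
    have "i = 2 * (i div 2) \<or> i = Suc (2 * (i div 2))" by presburger
    moreover have "m = i div 2 + (m - i div 2)" "1 \<le> m - i div 2" using i(1) n by auto
    ultimately show ?thesis using i(2) by metis
  qed
  fix x y
  assume xy: "x \<in> pverts (petersen n k)" "y \<in> pverts (petersen n k)"
    and "(from_inner n 0 x, from_inner n (Suc 0) x, from_inner n 2 x) =
      (from_inner n 0 y, from_inner n (Suc 0) y, from_inner n 2 y)"
  then have eq: "from_inner n 0 x = from_inner n 0 y" "from_inner n (Suc 0) x = from_inner n (Suc 0) y"
    "from_inner n 2 x = from_inner n 2 y" by simp_all
  obtain a r where a: "m = a + r" "1 \<le> r"
    and x: "x = Inner (2 * a) \<or> x = Inner (Suc (2 * a)) \<or> x = Outer (2 * a) \<or> x = Outer (Suc (2 * a))"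
    using split[OF xy(1)] by blast
  obtain b s where b: "m = b + s" "1 \<le> s"
    and y: "y = Inner (2 * b) \<or> y = Inner (Suc (2 * b)) \<or> y = Outer (2 * b) \<or> y = Outer (Suc (2 * b))"
    using split[OF xy(2)] by blast
  have "n = 2 * (a + r)" "3 \<le> a + r" "n = 2 * (b + s)" "3 \<le> b + s" using n a(1) b(1) by simp_all
  note dx = inner_distances_even[OF \<open>n = 2 * (a + r)\<close> a(2) \<open>3 \<le> a + r\<close>]
  note dy = inner_distances_even[OF \<open>n = 2 * (b + s)\<close> b(2) \<open>3 \<le> b + s\<close>]
  have sum: "a + r = b + s" using a(1) b(1) by simp
  show "x = y"
    \<comment> \<open>Each of the sixteen combinations of kind and parity becomes linear arithmetic
      in \<open>a\<close>, \<open>r\<close>, \<open>b\<close>, \<open>s\<close>.\<close>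
    using x y
    by (elim disjE; insert eq sum a(2) b(2) \<open>3 \<le> a + r\<close>;
        simp add: dx dy min_def split: if_splits)
qed

section \<open>Odd \<open>n\<close>: the landmarks \<open>Inner 0\<close>, \<open>Inner 1\<close>,
  \<open>Outer (m - 1)\<close>\<close>

lemma inner_distances_odd:
  assumes n: "n = Suc (2 * (a + r))" "3 \<le> a + r"
  shows "from_inner n 0 (Inner (2 * a)) = min a (r + 3)"
    and "from_inner n (Suc 0) (Inner (2 * a)) = (if a = 0 then 3 else min (a + 2) (r + 1))"
    and "from_inner n 0 (Outer (2 * a)) = min (a + 1) (r + 2)"
    and "from_inner n (Suc 0) (Outer (2 * a)) = (if a = 0 then 2 else min (a + 1) (r + 2))"
    and "1 \<le> r \<Longrightarrow> from_inner n 0 (Inner (Suc (2 * a))) = min (a + 3) r"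
    and "1 \<le> r \<Longrightarrow> from_inner n (Suc 0) (Inner (Suc (2 * a))) = min a (r + 3)"
    and "1 \<le> r \<Longrightarrow> from_inner n 0 (Outer (Suc (2 * a))) = min (a + 2) (r + 1)"
    and "1 \<le> r \<Longrightarrow> from_inner n (Suc 0) (Outer (Suc (2 * a))) = min (a + 1) (r + 2)"
proof -
  have lt: "0 < n" "Suc 0 < n" "2 * a < n" using assms by auto
  note simps = from_inner_simps(1)[OF lt(1)] from_inner_simps(1)[OF lt(2)]
     from_inner_simps(2)[OF lt(1)] from_inner_simps(2)[OF lt(2)]
  \<comment> \<open>For odd \<open>n\<close> the gaps in the two directions have opposite parity, so
    exactly one of them needs an odd number of index steps. Hence the different constants in the two
    arguments of each minimum.\<close>
  have *: "n - Suc (2 * a) = 2 * r" "n - 2 * a = Suc (2 * r)" using n by auto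
  show "from_inner n 0 (Inner (2 * a)) = min a (r + 3)"
    "from_inner n 0 (Outer (2 * a)) = min (a + 1) (r + 2)"
    by (simp_all add: simps lt *)
  show "1 \<le> r \<Longrightarrow> from_inner n 0 (Inner (Suc (2 * a))) = min (a + 3) r"
    "1 \<le> r \<Longrightarrow> from_inner n (Suc 0) (Inner (Suc (2 * a))) = min a (r + 3)"
    "1 \<le> r \<Longrightarrow> from_inner n 0 (Outer (Suc (2 * a))) = min (a + 2) (r + 1)"
    "1 \<le> r \<Longrightarrow> from_inner n (Suc 0) (Outer (Suc (2 * a))) = min (a + 1) (r + 2)"
  proof -
    assume "1 \<le> r"
    then have lt': "Suc (2 * a) < n" using n by auto
    show "from_inner n 0 (Inner (Suc (2 * a))) = min (a + 3) r"
      "from_inner n (Suc 0) (Inner (Suc (2 * a))) = min a (r + 3)"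
      "from_inner n 0 (Outer (Suc (2 * a))) = min (a + 2) (r + 1)"
      "from_inner n (Suc 0) (Outer (Suc (2 * a))) = min (a + 1) (r + 2)"
      by (simp_all add: simps lt lt' *)
  qed
  have "from_inner n (Suc 0) (Inner (2 * a)) = (if a = 0 then 3 else min (a + 2) (r + 1)) \<and>
    from_inner n (Suc 0) (Outer (2 * a)) = (if a = 0 then 2 else min (a + 1) (r + 2))"
  proof (cases a)
    case 0
    have s: "inner_span (Suc 0) = 3" "mixed_span (Suc 0) = 2"
      by (simp_all add: inner_span_def mixed_span_def)
    have "n - Suc 0 = 2 * r" using 0 n by simp
    then show ?thesis using 0 n(2) lt by (simp add: simps s)
  next
    case (Suc b)
    have d: "2 * a - Suc 0 = Suc (2 * b)" "n - Suc (2 * b) = 2 * Suc r"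
      and pos: "a \<noteq> 0" "Suc 0 \<le> 2 * a"
      using n Suc by simp_all
    show ?thesis
      unfolding simps(2)[OF lt(3)] simps(4)[OF lt(3)]
      by (simp only: d pos span_simps if_True if_False) (simp add: Suc)
  qed
  then show "from_inner n (Suc 0) (Inner (2 * a)) = (if a = 0 then 3 else min (a + 2) (r + 1))"
    "from_inner n (Suc 0) (Outer (2 * a)) = (if a = 0 then 2 else min (a + 1) (r + 2))" by blast+
qed

text \<open>The index \<open>m - 1\<close> is two away from \<open>m + 1\<close>, the index fixed by
  \<open>i \<mapsto> 1 - i\<close> modulo \<open>n\<close>; this offset is what lets the third
  landmark break the symmetry between \<open>Inner 0\<close> and \<open>Inner 1\<close>.\<close>

lemma outer_distance_odd:
  assumes n: "n = Suc (2 * m)" "3 \<le> m" and i: "i < n"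
  shows "m \<le> Suc i \<Longrightarrow> from_outer n (m - 1) (Inner i) =
      min (mixed_span (Suc i - m)) (mixed_span (3 * m - i))"
    and "m \<le> Suc i \<Longrightarrow> from_outer n (m - 1) (Outer i) =
      min (outer_span (Suc i - m)) (outer_span (3 * m - i))"
    and "Suc i < m \<Longrightarrow> from_outer n (m - 1) (Inner i) =
      min (mixed_span (m - Suc i)) (mixed_span (m + i + 2))"
    and "Suc i < m \<Longrightarrow> from_outer n (m - 1) (Outer i) =
      min (outer_span (m - Suc i)) (outer_span (m + i + 2))"
proof -
  have lt: "m - 1 < n" using n by simp
  note simps = from_outer_simps[OF lt i]
  show "from_outer n (m - 1) (Inner i) = min (mixed_span (Suc i - m)) (mixed_span (3 * m - i))"
    "from_outer n (m - 1) (Outer i) = min (outer_span (Suc i - m)) (outer_span (3 * m - i))"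
    if "m \<le> Suc i"
  proof -
    have "m - 1 \<le> i" "i - (m - 1) = Suc i - m" "n - (Suc i - m) = 3 * m - i" using that n by auto
    then show "from_outer n (m - 1) (Inner i) = min (mixed_span (Suc i - m)) (mixed_span (3 * m - i))"
      "from_outer n (m - 1) (Outer i) = min (outer_span (Suc i - m)) (outer_span (3 * m - i))"
      by (simp_all only: simps if_True)
  qed
  show "from_outer n (m - 1) (Inner i) = min (mixed_span (m - Suc i)) (mixed_span (m + i + 2))"
    "from_outer n (m - 1) (Outer i) = min (outer_span (m - Suc i)) (outer_span (m + i + 2))"
    if "Suc i < m"
  proof -
    have "\<not> m - 1 \<le> i" "m - 1 - i = m - Suc i" "n - (m - Suc i) = m + i + 2"
      using that n by auto
    then show "from_outer n (m - 1) (Inner i) = min (mixed_span (m - Suc i)) (mixed_span (m + i + 2))"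
      "from_outer n (m - 1) (Outer i) = min (outer_span (m - Suc i)) (outer_span (m + i + 2))"
      by (simp_all only: simps if_False)
  qed
qed

text \<open>
  The reflection \<open>i \<mapsto> 1 - i\<close> exchanges the landmarks \<open>u\<^sub>0\<close> and \<open>u\<^sub>1\<close>; the pairs of even outer vertices
  that it exchanges have to be separated by the third landmark.
\<close>

lemma outer_distance_odd_reflect:
  assumes n: "n = Suc (2 * m)" "3 \<le> m" and ij: "i < j" "j < n" "i + j = 2 * m + 2" "even i"
  shows "from_outer n (m - 1) (Outer i) < from_outer n (m - 1) (Outer j)"
proof -
  \<comment> \<open>\<open>t\<close> is the offset of both indices from the fixed index
    \<open>m + 1\<close>. Seen from the landmark \<open>m - 1\<close>, index \<open>j\<close> lies
    \<open>t + 2\<close> ahead, while \<open>i\<close> is only \<open>|t - 2|\<close> away; the case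
    split on \<open>t \<le> 2\<close> decides on which side.\<close>
  obtain t where t: "i = m + 1 - t" "j = m + 1 + t" "1 \<le> t" "t + 1 \<le> m"
    using ij n by (intro that[of "j - m - 1"]) auto
  have j: "from_outer n (m - 1) (Outer j) = min (outer_span (t + 2)) (outer_span (2 * m - 1 - t))"
    using outer_distance_odd(2)[OF n ij(2)] t by simp
  show ?thesis
  proof (cases "t \<le> 2")
    case True
    then have "m \<le> Suc i" "Suc i - m = 2 - t" using t by auto
    then have "from_outer n (m - 1) (Outer i) \<le> outer_span (2 - t)"
      using outer_distance_odd(2)[OF n, of i] ij by simp
    also have "\<dots> < from_outer n (m - 1) (Outer j)"
      unfolding j using outer_span_strict[of "2 - t" "t + 2"]
        outer_span_strict[of "2 - t" "2 * m - 1 - t"] t n by simp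
    finally show ?thesis .
  next
    case False
    then have "Suc i < m" "m - Suc i = t - 2" using t by auto
    then have "from_outer n (m - 1) (Outer i) \<le> outer_span (t - 2)"
      using outer_distance_odd(4)[OF n, of i] ij by simp
    also have "\<dots> < from_outer n (m - 1) (Outer j)"
      unfolding j using outer_span_strict[of "t - 2" "t + 2"]
        outer_span_strict[of "t - 2" "2 * m - 1 - t"] t False by simp
    finally show ?thesis .
  qed
qed

text \<open>Apart from reflected pairs of outer vertices and one coincidence for
  \<open>n = 7\<close>, vertices with equal distances to \<open>Inner 0\<close> and
  \<open>Inner 1\<close> have indices at bounded offset from \<open>m\<close>. These are the third
  distances that tell them apart. Where only a lower bound is given, the way round the other side is
  shorter for the smallest \<open>m\<close>.\<close>

lemma outer_distance_odd_Inner_values: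
  assumes n: "n = Suc (2 * m)" "3 \<le> m" and i: "i < n"
  shows "i + 2 = m \<Longrightarrow> from_outer n (m - 1) (Inner i) = 2"
    and "i + 1 = m \<Longrightarrow> from_outer n (m - 1) (Inner i) = 1"
    and "i = m \<Longrightarrow> from_outer n (m - 1) (Inner i) = 2"
    and "i = m + 1 \<Longrightarrow> from_outer n (m - 1) (Inner i) = 2"
    and "i = m + 2 \<Longrightarrow> from_outer n (m - 1) (Inner i) = 3"
    and "i = m + 3 \<Longrightarrow> from_outer n (m - 1) (Inner i) = 3"
    and "i = m + 4 \<Longrightarrow> 3 \<le> from_outer n (m - 1) (Inner i)"
  using outer_distance_odd(1,3)[OF n i] n i by (auto simp: mixed_span_def)

lemma outer_distance_odd_Outer_values:
  assumes n: "n = Suc (2 * m)" "3 \<le> m" and i: "i < n"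
  shows "i + 3 = m \<Longrightarrow> from_outer n (m - 1) (Outer i) = 2"
    and "i + 2 = m \<Longrightarrow> from_outer n (m - 1) (Outer i) = 1"
    and "i + 1 = m \<Longrightarrow> from_outer n (m - 1) (Outer i) = 0"
    and "i = m \<Longrightarrow> from_outer n (m - 1) (Outer i) = 1"
    and "i = m + 1 \<Longrightarrow> from_outer n (m - 1) (Outer i) = 2"
    and "i = m + 2 \<Longrightarrow> from_outer n (m - 1) (Outer i) = 3"
    and "i = m + 3 \<Longrightarrow> 3 \<le> from_outer n (m - 1) (Outer i)"
    and "i = m + 4 \<Longrightarrow> 4 \<le> from_outer n (m - 1) (Outer i)"
  using outer_distance_odd(2,4)[OF n i] n i by (auto simp: outer_span_def)

text \<open>Ten facts, one for each pair of classes given by kind and parity. In each, the distances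
  to \<open>Inner 0\<close> and \<open>Inner 1\<close> either settle the matter or leave a few index
  pairs, which the third landmark separates.\<close>

lemma inner_distances_inj_odd:
  assumes n: "n = Suc (2 * m)" "3 \<le> m"
  shows "inj_on (\<lambda>x. (from_inner n 0 x, from_inner n (Suc 0) x, from_outer n (m - 1) x)) (pverts (petersen n k))"
proof -
  define T where "T x = (from_inner n 0 x, from_inner n (Suc 0) x, from_outer n (m - 1) x)" for x
  have T: "T x = T y \<longleftrightarrow> from_inner n 0 x = from_inner n 0 y \<and>
      from_inner n (Suc 0) x = from_inner n (Suc 0) y \<and>
      from_outer n (m - 1) x = from_outer n (m - 1) y" for x y
    by (simp add: T_def)
  note inner = inner_distances_odd[where n = n]
  note vI = outer_distance_odd_Inner_values[OF n]
  note vO = outer_distance_odd_Outer_values[OF n]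
  have dist: "n = Suc (2 * (a + r))" "3 \<le> a + r" if "m = a + r" for a r using n that by simp_all

  have inner_even_even: "a = b" if "T (Inner (2 * a)) = T (Inner (2 * b))" "m = a + r" "m = b + s" for a r b s
  proof -
    have "min a (r + 3) = min b (s + 3)"
      "(if a = 0 then 3 else min (a + 2) (r + 1)) = (if b = 0 then 3 else min (b + 2) (s + 1))"
      using that(1) unfolding T inner[OF dist[OF that(2)]] inner[OF dist[OF that(3)]] by blast+
    then show ?thesis using that(2,3) n(2) by (simp add: min_def split: if_splits)
  qed
  have inner_odd_odd: "a = b" if "T (Inner (Suc (2 * a))) = T (Inner (Suc (2 * b)))"
    "m = a + r" "m = b + s" "1 \<le> r" "1 \<le> s" for a r b s
  proof -
    have "min (a + 3) r = min (b + 3) s" "min a (r + 3) = min b (s + 3)"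
      using that(1) unfolding T inner(5-)[OF dist[OF that(2)] that(4)] inner(5-)[OF dist[OF that(3)] that(5)]
      by blast+
    then show ?thesis using that(2-) n(2) by (simp add: min_def split: if_splits)
  qed
  have inner_even_odd: "T (Inner (2 * a)) \<noteq> T (Inner (Suc (2 * b)))"
    if "m = a + r" "m = b + s" "1 \<le> s" for a r b s
  proof
    assume eq: "T (Inner (2 * a)) = T (Inner (Suc (2 * b)))"
    then have "min a (r + 3) = min (b + 3) s"
      "(if a = 0 then 3 else min (a + 2) (r + 1)) = min b (s + 3)"
      unfolding T inner(1-4)[OF dist[OF that(1)]] inner(5-)[OF dist[OF that(2)] that(3)] by blast+
    \<comment> \<open>Linear arithmetic leaves just these two pairs of indices near
      \<open>m\<close>; \<open>vI\<close> then gives different third coordinates.\<close>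
    then have "2 * a + 2 = m \<and> 2 * b = m + 2 \<or> 2 * a = m + 4 \<and> 2 * b + 2 = m"
      using that n(2) by (simp add: min_def split: if_splits)
    moreover have "2 * a < n" "Suc (2 * b) < n" using that n by simp_all
    ultimately show False using eq vI(1,7)[of "2 * a"] vI(6,2)[of "Suc (2 * b)"]
      by (auto simp: T)
  qed
  have outer_even_even: "a = b" if eq: "T (Outer (2 * a)) = T (Outer (2 * b))" "m = a + r" "m = b + s" for a r b s
  proof (rule ccontr)
    assume "a \<noteq> b"
    have "min (a + 1) (r + 2) = min (b + 1) (s + 2)"
      using that(1) unfolding T inner[OF dist[OF that(2)]] inner[OF dist[OF that(3)]] by blast
    \<comment> \<open>The first coordinate alone forces the two indices to be reflections of each
      other, the situation of \<open>outer_distance_odd_reflect\<close>.\<close>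
    then have sum: "2 * a + 2 * b = 2 * m + 2"
      using that(2,3) n(2) \<open>a \<noteq> b\<close> by (simp add: min_def split: if_splits)
    moreover have lt: "2 * a < n" "2 * b < n" using that n by simp_all
    moreover have "2 * a < 2 * b \<or> 2 * b < 2 * a" using \<open>a \<noteq> b\<close> by linarith
    ultimately show False
      using eq outer_distance_odd_reflect[OF n, of "2 * a" "2 * b"]
        outer_distance_odd_reflect[OF n, of "2 * b" "2 * a"] by (auto simp: T)
  qed
  have outer_odd_odd: "a = b" if "T (Outer (Suc (2 * a))) = T (Outer (Suc (2 * b)))"
    "m = a + r" "m = b + s" "1 \<le> r" "1 \<le> s" for a r b s
  proof -
    have "min (a + 2) (r + 1) = min (b + 2) (s + 1)" "min (a + 1) (r + 2) = min (b + 1) (s + 2)"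
      using that(1) unfolding T inner(5-)[OF dist[OF that(2)] that(4)] inner(5-)[OF dist[OF that(3)] that(5)]
      by blast+
    then show ?thesis using that(2-) n(2) by (simp add: min_def split: if_splits)
  qed
  have outer_even_odd: "T (Outer (2 * a)) \<noteq> T (Outer (Suc (2 * b)))"
    if "m = a + r" "m = b + s" "1 \<le> s" for a r b s
  proof
    assume eq: "T (Outer (2 * a)) = T (Outer (Suc (2 * b)))"
    then have "min (a + 1) (r + 2) = min (b + 2) (s + 1)"
      "(if a = 0 then 2 else min (a + 1) (r + 2)) = min (b + 1) (s + 2)"
      unfolding T inner(1-4)[OF dist[OF that(1)]] inner(5-)[OF dist[OF that(2)] that(3)] by blast+
    then have "2 * b = m \<and> (2 * a = m \<or> 2 * a = m + 2)"
      using that n(2) by (simp add: min_def split: if_splits)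
    moreover have "2 * a < n" "Suc (2 * b) < n" using that n by simp_all
    ultimately show False using eq vO(4,6)[of "2 * a"] vO(5)[of "Suc (2 * b)"]
      by (auto simp: T)
  qed
  have mixed_even_even: "T (Inner (2 * a)) \<noteq> T (Outer (2 * b))" if "m = a + r" "m = b + s" for a r b s
  proof
    assume eq: "T (Inner (2 * a)) = T (Outer (2 * b))"
    then have "min a (r + 3) = min (b + 1) (s + 2)"
      "(if a = 0 then 3 else min (a + 2) (r + 1)) = (if b = 0 then 2 else min (b + 1) (s + 2))"
      unfolding T inner(1-4)[OF dist[OF that(1)]] inner(1-4)[OF dist[OF that(2)]] by blast+
    then have "2 * a = m + 1 \<and> (2 * b + 1 = m \<or> 2 * b = m + 3)"
      using that n(2) by (simp add: min_def split: if_splits)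
    moreover have "2 * a < n" "2 * b < n" using that n by simp_all
    ultimately show False using eq vI(4)[of "2 * a"] vO(3,7)[of "2 * b"]
      by (auto simp: T)
  qed
  have mixed_even_odd: "T (Inner (2 * a)) \<noteq> T (Outer (Suc (2 * b)))"
    if "m = a + r" "m = b + s" "1 \<le> s" for a r b s
  proof
    assume eq: "T (Inner (2 * a)) = T (Outer (Suc (2 * b)))"
    then have "min a (r + 3) = min (b + 2) (s + 1)"
      "(if a = 0 then 3 else min (a + 2) (r + 1)) = min (b + 1) (s + 2)"
      unfolding T inner(1-4)[OF dist[OF that(1)]] inner(5-)[OF dist[OF that(2)] that(3)] by blast+
    then have "2 * a = m + 2 \<and> 2 * b + 2 = m \<or> 2 * a = m \<and> 2 * b = m + 2"
      using that n(2) by (simp add: min_def split: if_splits)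
    moreover have "2 * a < n" "Suc (2 * b) < n" using that n by simp_all
    ultimately show False using eq vI(5,3)[of "2 * a"] vO(3,7)[of "Suc (2 * b)"]
      by (auto simp: T)
  qed
  have mixed_odd_even: "T (Inner (Suc (2 * a))) \<noteq> T (Outer (2 * b))"
    if "m = a + r" "m = b + s" "1 \<le> r" for a r b s
  proof
    assume eq: "T (Inner (Suc (2 * a))) = T (Outer (2 * b))"
    then have "min (a + 3) r = min (b + 1) (s + 2)"
      "min a (r + 3) = (if b = 0 then 2 else min (b + 1) (s + 2))"
      unfolding T inner(5-)[OF dist[OF that(1)] that(3)] inner(1-4)[OF dist[OF that(2)]] by blast+
    \<comment> \<open>The last alternative is the coincidence of \<open>Inner 5\<close> and
      \<open>Outer 0\<close> for \<open>n = 7\<close>, due to the special value at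
      \<open>b = 0\<close>.\<close>
    then have "2 * a = m \<and> (2 * b + 2 = m \<or> 2 * b = m + 4) \<or> m = 3 \<and> a = 2 \<and> b = 0"
      using that n(2) by (simp add: min_def split: if_splits)
    moreover have "Suc (2 * a) < n" "2 * b < n" using that n by simp_all
    ultimately show False using eq vI(4,5)[of "Suc (2 * a)"] vO(1,2,8)[of "2 * b"]
      by (auto simp: T)
  qed
  have mixed_odd_odd: "T (Inner (Suc (2 * a))) \<noteq> T (Outer (Suc (2 * b)))"
    if "m = a + r" "m = b + s" "1 \<le> r" "1 \<le> s" for a r b s
  proof
    assume eq: "T (Inner (Suc (2 * a))) = T (Outer (Suc (2 * b)))"
    then have "min (a + 3) r = min (b + 2) (s + 1)" "min a (r + 3) = min (b + 1) (s + 2)"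
      unfolding T inner(5-)[OF dist[OF that(1)] that(3)] inner(5-)[OF dist[OF that(2)] that(4)] by blast+
    then have "2 * a + 1 = m \<and> 2 * b + 3 = m \<or> 2 * a = m + 1 \<and> 2 * b = m + 3"
      using that n(2) by (simp add: min_def split: if_splits)
    moreover have "Suc (2 * a) < n" "Suc (2 * b) < n" using that n by simp_all
    ultimately show False using eq vI(3,5)[of "Suc (2 * a)"] vO(2,8)[of "Suc (2 * b)"]
      by (auto simp: T)
  qed

  have split: "\<exists>a r. m = a + r \<and> (x = Inner (2 * a) \<or> x = Outer (2 * a) \<or>
      1 \<le> r \<and> (x = Inner (Suc (2 * a)) \<or> x = Outer (Suc (2 * a))))"
    if "x \<in> pverts (petersen n k)" for x
  proof -
    obtain i where i: "i < n" "x = Inner i \<or> x = Outer i" using \<open>x \<in> _\<close> by (auto simp: pverts_petersen)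
    have "i = 2 * (i div 2) \<or> i = Suc (2 * (i div 2))" by presburger
    moreover have "m = i div 2 + (m - i div 2)" using i(1) n by auto
    moreover have "1 \<le> m - i div 2" if "i = Suc (2 * (i div 2))" using i(1) n that by linarith
    ultimately show ?thesis using i(2) by metis
  qed
  have "x = y" if xy: "x \<in> pverts (petersen n k)" "y \<in> pverts (petersen n k)" and eq: "T x = T y" for x y
  proof -
    obtain a r where a: "m = a + r" and x: "x = Inner (2 * a) \<or> x = Outer (2 * a) \<or>
        1 \<le> r \<and> (x = Inner (Suc (2 * a)) \<or> x = Outer (Suc (2 * a)))"
      using split[OF xy(1)] by blast
    obtain b s where b: "m = b + s" and y: "y = Inner (2 * b) \<or> y = Outer (2 * b) \<or>
        1 \<le> s \<and> (y = Inner (Suc (2 * b)) \<or> y = Outer (Suc (2 * b)))"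
      using split[OF xy(2)] by blast
    \<comment> \<open>Facts about two different classes are stated in one order only, so they are
      instantiated both ways.\<close>
    note ab = a b and ba = b a
    show ?thesis
      using x y eq inner_even_even[OF _ ab] inner_odd_odd[OF _ ab] inner_even_odd[OF ab] inner_even_odd[OF ba]
        outer_even_even[OF _ ab] outer_odd_odd[OF _ ab] outer_even_odd[OF ab] outer_even_odd[OF ba]
        mixed_even_even[OF ab] mixed_even_even[OF ba] mixed_even_odd[OF ab] mixed_even_odd[OF ba]
        mixed_odd_even[OF ab] mixed_odd_even[OF ba] mixed_odd_odd[OF ab] mixed_odd_odd[OF ba]
      by metis
  qed
  then show ?thesis unfolding T_def inj_on_def by blast
qed

section \<open>The upper bound\<close>

lemma metric_dimension_petersen_le_3:
  assumes n: "n \<ge> 5"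
  shows "metric_dimension (petersen n 2) \<le> 3"
proof -
  have inner: "graph_dist (petersen n 2) x (Inner c) = ereal (real (from_inner n c x))"
    and outer: "graph_dist (petersen n 2) x (Outer c) = ereal (real (from_outer n c x))"
    if "c < n" "x \<in> pverts (petersen n 2)" for x c
    using that n graph_dist_Inner graph_dist_Outer by (simp_all add: from_inner_def from_outer_def)
  obtain a b c where "resolving_set (petersen n 2) {a, b, c}" and "a \<noteq> b" "a \<noteq> c" "b \<noteq> c"
  proof -
    consider "n = 5" | m where "n = 2 * m" "3 \<le> m" | m where "n = Suc (2 * m)" "3 \<le> m"
    proof (cases "even n")
      case True
      then show ?thesis using n that(2) by (auto elim!: evenE)
    next
      case False
      then obtain m where "n = Suc (2 * m)" by (auto elim!: oddE)
      with n that(1) that(3)[of m] show ?thesis by (cases "m = 2") auto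
    qed
    then show ?thesis
    proof cases
      case 1
      \<comment> \<open>Here \<open>m = 2\<close>, below the range of the odd case, so the ten
        distance triples are computed.\<close>
      have "{..<5::nat} = {0, 1, 2, 3, 4}" by auto
      then have pverts: "pverts (petersen n 2) = {Inner 0, Inner 1, Inner 2, Inner 3, Inner 4,
          Outer 0, Outer 1, Outer 2, Outer 3, Outer 4}"
        by (auto simp: pverts_petersen 1)
      have "inj_on (\<lambda>x. (from_inner n 0 x, from_inner n 1 x, from_outer n 2 x)) (pverts (petersen n 2))"
        unfolding pverts
        by (simp add: 1 from_inner_def from_outer_def inner_span_def mixed_span_def outer_span_def)
      then have "resolving_set (petersen n 2) {Inner 0, Inner 1, Outer 2}"
        by (intro resolving_set_three[OF _ inner inner outer]) (simp_all add: 1)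
      then show ?thesis by (rule that) auto
    next
      case (2 m)
      then have "resolving_set (petersen n 2) {Inner 0, Inner (Suc 0), Inner 2}"
        by (intro resolving_set_three[OF _ inner inner inner] inner_distances_inj_even) simp_all
      then show ?thesis by (rule that) auto
    next
      case (3 m)
      then have "resolving_set (petersen n 2) {Inner 0, Inner (Suc 0), Outer (m - 1)}"
        by (intro resolving_set_three[OF _ inner inner outer] inner_distances_inj_odd) simp_all
      then show ?thesis by (rule that) auto
    qed
  qed
  then have "\<exists>W. resolving_set (petersen n 2) W \<and> card W = 3" by (intro exI[of _ "{a, b, c}"]) auto
  then show ?thesis unfolding metric_dimension_def by (rule Least_le)
qed

section \<open>No two landmarks resolve a spanning supergraph\<close>

text \<open>
  \<open>X\<close> and \<open>Y\<close> abstract the distances to the landmarks \<open>a\<close> and \<open>b\<close> in a spanning supergraph, whose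
  remaining edges play no role.
\<close>

locale petersen_coordinates =
  fixes n :: nat and X Y :: "petersen_vertex \<Rightarrow> nat" and a b :: petersen_vertex and k :: nat
  assumes n: "5 \<le> n"
    and landmarks: "a \<in> pverts (petersen n 2)" "b \<in> pverts (petersen n 2)" "a \<noteq> b"
    and zero: "\<And>x. x \<in> pverts (petersen n 2) \<Longrightarrow> X x = 0 \<longleftrightarrow> x = a"
      "\<And>x. x \<in> pverts (petersen n 2) \<Longrightarrow> Y x = 0 \<longleftrightarrow> x = b"
    and between: "X b = k" "Y a = k"
    and lipschitz: "\<And>x y. (x, y) \<in> parcs (petersen n 2) \<Longrightarrow> X y \<le> Suc (X x)"
      "\<And>x y. (x, y) \<in> parcs (petersen n 2) \<Longrightarrow> Y y \<le> Suc (Y x)"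
    and triangle: "\<And>x. x \<in> pverts (petersen n 2) \<Longrightarrow> Y x \<le> X x + k"
      "\<And>x. x \<in> pverts (petersen n 2) \<Longrightarrow> X x \<le> Y x + k"
      "\<And>x. x \<in> pverts (petersen n 2) \<Longrightarrow> k \<le> X x + Y x"
    and inj: "inj_on (\<lambda>x. (X x, Y x)) (pverts (petersen n 2))"
begin

text \<open>Makes every counting lemma below available around \<open>b\<close> as well.\<close>

lemma swap: "petersen_coordinates n Y X b a k"
proof
  show "inj_on (\<lambda>x. (Y x, X x)) (pverts (petersen n 2))"
    using inj by (auto simp: inj_on_def)
qed (use n landmarks zero between lipschitz triangle in \<open>auto simp: add.commute\<close>)

text \<open>By injectivity there are at most as many vertices as coordinate pairs. Using a list
  makes the bound independent of repetitions, which can occur for symbolic \<open>k\<close>.\<close>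

lemma card_le:
  assumes "S \<subseteq> pverts (petersen n 2)" "\<And>x. x \<in> S \<Longrightarrow> (X x, Y x) \<in> set ps"
  shows "card S \<le> length ps"
proof -
  have "card S = card ((\<lambda>x. (X x, Y x)) ` S)"
    using inj_on_subset[OF inj assms(1)] by (simp add: card_image)
  also have "\<dots> \<le> card (set ps)" using assms(2) by (intro card_mono) auto
  also have "\<dots> \<le> length ps" by (rule card_length)
  finally show ?thesis .
qed

lemma k_pos: "0 < k"
  using zero(1)[of b] landmarks between by auto

text \<open>Truncated subtraction for \<open>k < 2\<close> only adds spurious or repeated points to this list.\<close>

definition near_points :: "(nat \<times> nat) list" where
  "near_points = [(0, k), (1, k - 1), (1, k), (1, k + 1),
    (2, k - 2), (2, k - 1), (2, k), (2, k + 1), (2, k + 2)]"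

lemma near_points:
  assumes "x \<in> pverts (petersen n 2)" "X x \<le> 2"
  shows "(X x, Y x) \<in> set near_points"
proof -
  note triangle = triangle(1,3)[OF assms(1)]
  consider "X x = 0" | "X x = 1" | "X x = 2" using assms(2) by linarith
  then show ?thesis
  proof cases
    case 1
    then have "Y x = k" using zero(1)[OF assms(1)] between by simp
    with 1 show ?thesis by (simp add: near_points_def)
  next
    case 2
    then have "Y x = k - 1 \<or> Y x = k \<or> Y x = k + 1" using triangle by linarith
    with 2 show ?thesis by (auto simp: near_points_def)
  next
    case 3
    then have "Y x = k - 2 \<or> Y x = k - 1 \<or> Y x = k \<or> Y x = k + 1 \<or> Y x = k + 2"
      using triangle by linarith
    with 3 show ?thesis by (auto simp: near_points_def)
  qed
qed

lemma card_near:
  assumes "S \<subseteq> pverts (petersen n 2)" "\<And>x. x \<in> S \<Longrightarrow> X x \<le> 2"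
  shows "card S \<le> 9"
proof -
  have "(X x, Y x) \<in> set near_points" if "x \<in> S" for x
    using near_points assms that by auto
  from card_le[OF assms(1) this] show ?thesis by (simp add: near_points_def)
qed

text \<open>Pigeonhole: nine vertices with distinct images among at most nine points hit every
  point.\<close>

lemma near_point_occupied:
  assumes S: "S \<subseteq> pverts (petersen n 2)" "\<And>x. x \<in> S \<Longrightarrow> X x \<le> 2" "card S = 9"
    and p: "p \<in> set near_points"
  obtains x where "x \<in> S" "(X x, Y x) = p"
proof -
  let ?f = "\<lambda>x. (X x, Y x)"
  have sub: "?f ` S \<subseteq> set near_points" using S near_points by auto
  have "card (?f ` S) = 9" using inj_on_subset[OF inj S(1)] S(3) by (simp add: card_image)
  moreover have "card (set near_points) \<le> 9" using card_length[of near_points] by (simp add: near_points_def)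
  ultimately have "?f ` S = set near_points" using sub by (intro card_seteq) auto
  with p have "p \<in> ?f ` S" by simp
  then show thesis by (elim imageE) (use that in simp)
qed

text \<open>A tenth vertex would violate \<open>card_near\<close>; so nine known vertices are the
  whole ball of radius 2.\<close>

lemma near_in_full_ball:
  assumes S: "S \<subseteq> pverts (petersen n 2)" "\<And>x. x \<in> S \<Longrightarrow> X x \<le> 2" "card S = 9"
    and x: "x \<in> pverts (petersen n 2)" "X x \<le> 2"
  shows "x \<in> S"
proof (rule ccontr)
  assume "x \<notin> S"
  moreover have "finite S" using S(3) card.infinite by fastforce
  ultimately have "card (insert x S) = 10" using S(3) by simp
  with card_near[of "insert x S"] S x show False by auto
qed

lemma card_unit_sphere:
  assumes "S \<subseteq> pverts (petersen n 2)" "\<And>x. x \<in> S \<Longrightarrow> X x = 1"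
  shows "card S \<le> 3"
proof -
  have "(X x, Y x) \<in> set [(1, k - 1), (1, k), (1, k + 1)]" if "x \<in> S" for x
  proof -
    have "x \<in> pverts (petersen n 2)" "X x = 1" using assms that by auto
    with triangle(1,3)[of x] have "Y x = k - 1 \<or> Y x = k \<or> Y x = k + 1" by linarith
    with \<open>X x = 1\<close> show ?thesis by auto
  qed
  from card_le[OF assms(1) this] show ?thesis by simp
qed

text \<open>For \<open>k = 1\<close> the inequality \<open>X x \<le> Y x + k\<close> also cuts off
  \<open>(2, 0)\<close>, which leaves 1 + 3 + 3 points.\<close>

lemma card_near_adjacent:
  assumes "k \<le> 1" and S: "S \<subseteq> pverts (petersen n 2)" "\<And>x. x \<in> S \<Longrightarrow> X x \<le> 2"
  shows "card S \<le> 7"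
proof -
  have k: "k = 1" using k_pos assms(1) by simp
  have "(X x, Y x) \<in> set [(0, 1), (1, 0), (1, 1), (1, 2), (2, 1), (2, 2), (2, 3)]" if xS: "x \<in> S" for x
  proof -
    have x: "x \<in> pverts (petersen n 2)" using S(1) that by auto
    note triangle = triangle(1,2)[OF x, unfolded k]
    consider "X x = 0" | "X x = 1" | "X x = 2" using S(2)[OF xS] by linarith
    then show ?thesis
    proof cases
      case 1
      then have "Y x = 1" using zero(1)[OF x] between k by simp
      with 1 show ?thesis by simp
    next
      case 2
      then have "Y x = 0 \<or> Y x = 1 \<or> Y x = 2" using triangle by linarith
      with 2 show ?thesis by auto
    next
      case 3
      then have "Y x = 1 \<or> Y x = 2 \<or> Y x = 3" using triangle by linarith
      with 3 show ?thesis by auto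
    qed
  qed
  from card_le[OF S(1) this] show ?thesis by simp
qed

text \<open>Since \<open>k \<le> X x + Y x\<close>, only points of the square up to
  \<open>(2, 2)\<close> with coordinate sum at least \<open>k\<close> remain.\<close>

lemma card_common:
  assumes S: "S \<subseteq> pverts (petersen n 2)" "\<And>x. x \<in> S \<Longrightarrow> X x \<le> 2" "\<And>x. x \<in> S \<Longrightarrow> Y x \<le> 2"
  shows "3 \<le> k \<Longrightarrow> card S \<le> 3" and "4 \<le> k \<Longrightarrow> card S \<le> 1"
proof -
  have x: "X x \<le> 2" "Y x \<le> 2" "k \<le> X x + Y x" if "x \<in> S" for x
    using that S triangle(3)[of x] by auto
  have "(X x, Y x) \<in> set [(1, 2), (2, 1), (2, 2)]" if "3 \<le> k" "x \<in> S" for x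
  proof -
    have "X x = 1 \<and> Y x = 2 \<or> X x = 2 \<and> Y x = 1 \<or> X x = 2 \<and> Y x = 2"
      using x[OF that(2)] that(1) by linarith
    then show ?thesis by auto
  qed
  from card_le[OF S(1) this] show "card S \<le> 3" if "3 \<le> k" using that by simp
  have "(X x, Y x) \<in> set [(2, 2)]" if "4 \<le> k" "x \<in> S" for x
  proof -
    have "X x = 2 \<and> Y x = 2" using x[OF that(2)] that(1) by linarith
    then show ?thesis by simp
  qed
  from card_le[OF S(1) this] show "card S \<le> 1" if "4 \<le> k" using that by simp
qed

lemma card_common_neighbours:
  assumes "2 \<le> k"
    and S: "S \<subseteq> pverts (petersen n 2)" "\<And>x. x \<in> S \<Longrightarrow> X x \<le> 1" "\<And>x. x \<in> S \<Longrightarrow> Y x \<le> 1"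
  shows "card S \<le> 1"
proof -
  have "(X x, Y x) \<in> set [(1, 1)]" if "x \<in> S" for x
  proof -
    have "k \<le> X x + Y x" using triangle(3) S(1) that by auto
    then have "X x = 1 \<and> Y x = 1" using S(2,3)[OF that] assms(1) by linarith
    then show ?thesis by simp
  qed
  from card_le[OF S(1) this] show ?thesis by simp
qed

end

section \<open>Balls in \<open>P(n,2)\<close> and the position of the landmarks\<close>

lemma petersen_coordinates_rotate:
  assumes "petersen_coordinates n X Y (rotate_vertex n c a) (rotate_vertex n c b) k"
    and "c \<le> n" and ab: "a \<in> pverts (petersen n 2)" "b \<in> pverts (petersen n 2)"
  shows "petersen_coordinates n (\<lambda>x. X (rotate_vertex n c x)) (\<lambda>x. Y (rotate_vertex n c x)) a b k"
proof -
  interpret petersen_coordinates n X Y "rotate_vertex n c a" "rotate_vertex n c b" k by fact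
  have eq: "rotate_vertex n c x = rotate_vertex n c y \<longleftrightarrow> x = y"
    if "x \<in> pverts (petersen n 2)" "y \<in> pverts (petersen n 2)" for x y
    using rotate_vertex_inverse(2)[OF that(1) assms(2)] rotate_vertex_inverse(2)[OF that(2) assms(2)]
    by metis
  note verts = rotate_vertex_in_pverts[where k = 2]
  show ?thesis
  proof
    show "a \<noteq> b" using landmarks(3) by auto
    show "inj_on (\<lambda>x. (X (rotate_vertex n c x), Y (rotate_vertex n c x))) (pverts (petersen n 2))"
      using inj verts eq unfolding inj_on_def by blast
    fix x y
    show "X (rotate_vertex n c y) \<le> Suc (X (rotate_vertex n c x))"
      and "Y (rotate_vertex n c y) \<le> Suc (Y (rotate_vertex n c x))"
      if "(x, y) \<in> parcs (petersen n 2)"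
      using lipschitz rotate_vertex_arc[OF that] by simp_all
    assume x: "x \<in> pverts (petersen n 2)"
    show "X (rotate_vertex n c x) = 0 \<longleftrightarrow> x = a" "Y (rotate_vertex n c x) = 0 \<longleftrightarrow> x = b"
      using zero[OF verts[OF x]] eq[OF x] ab by simp_all
    show "Y (rotate_vertex n c x) \<le> X (rotate_vertex n c x) + k"
      "X (rotate_vertex n c x) \<le> Y (rotate_vertex n c x) + k"
      "k \<le> X (rotate_vertex n c x) + Y (rotate_vertex n c x)"
      using triangle[OF verts[OF x]] by simp_all
  qed (rule n ab between)+
qed

text \<open>\<open>f\<close> will be the distance to a landmark in the supergraph, where added edges
  can only shrink distances. Negative offsets are written as \<open>n - c\<close>, and the listed
  vertices may coincide for small \<open>n\<close>.\<close>

lemma petersen_ball: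
  fixes f :: "petersen_vertex \<Rightarrow> nat"
  assumes lipschitz: "\<And>x y. (x, y) \<in> parcs (petersen n 2) \<Longrightarrow> f y \<le> Suc (f x)"
    and i: "i < n" and n: "5 \<le> n"
  shows "f (Inner i) = 0 \<Longrightarrow> x \<in> {Inner ((i + 2) mod n), Inner ((i + (n - 2)) mod n), Outer i} \<Longrightarrow> f x \<le> 1"
    and "f (Inner i) = 0 \<Longrightarrow> x \<in> {Inner i, Inner ((i + 2) mod n), Inner ((i + (n - 2)) mod n),
        Inner ((i + 4) mod n), Inner ((i + (n - 4)) mod n), Outer i, Outer ((i + 1) mod n),
        Outer ((i + (n - 1)) mod n), Outer ((i + 2) mod n), Outer ((i + (n - 2)) mod n)} \<Longrightarrow> f x \<le> 2"
    and "f (Outer i) = 0 \<Longrightarrow> x \<in> {Outer i, Outer ((i + 1) mod n), Outer ((i + (n - 1)) mod n),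
        Outer ((i + 2) mod n), Outer ((i + (n - 2)) mod n), Inner i, Inner ((i + 1) mod n),
        Inner ((i + (n - 1)) mod n), Inner ((i + 2) mod n), Inner ((i + (n - 2)) mod n)} \<Longrightarrow> f x \<le> 2"
proof -
  let ?p = "\<lambda>c. (i + c) mod n"
  have p: "?p c < n" for c using n by simp
  have shift: "(?p c + d) mod n = ?p (c + d)" for c d by (simp add: mod_add_left_eq add.assoc)
  have 0: "?p 0 = i" "?p n = i" using i by simp_all
  have spoke: "f (Outer (?p c)) \<le> Suc (f (Inner (?p c)))" "f (Inner (?p c)) \<le> Suc (f (Outer (?p c)))" for c
    using lipschitz petersen_arcI(3,4)[OF p] by blast+
  have outer: "f (Outer (?p (c + 1))) \<le> Suc (f (Outer (?p c)))" "f (Outer (?p c)) \<le> Suc (f (Outer (?p (c + 1))))" for c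
    using lipschitz petersen_arcI(1,2)[OF p] unfolding shift by blast+
  have inner: "f (Inner (?p (c + 2))) \<le> Suc (f (Inner (?p c)))" "f (Inner (?p c)) \<le> Suc (f (Inner (?p (c + 2))))" for c
    using lipschitz petersen_arcI(5,6)[OF p, where k = 2] unfolding shift by blast+
  have n1: "n - 1 + 1 = n" "n - 2 + 1 = n - 1" "n - 2 + 2 = n" "n - 4 + 2 = n - 2"
    "(0 :: nat) + 1 = 1" "(0 :: nat) + 2 = 2" "(1 :: nat) + 1 = 2" "(2 :: nat) + 2 = 4" using n by simp_all
  have I: "f (Inner (?p 2)) \<le> 1" "f (Inner (?p (n - 2))) \<le> 1" "f (Outer i) \<le> 1"
    "f (Inner (?p 4)) \<le> 2" "f (Inner (?p (n - 4))) \<le> 2"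
    "f (Outer (?p 1)) \<le> 2" "f (Outer (?p (n - 1))) \<le> 2"
    "f (Outer (?p 2)) \<le> 2" "f (Outer (?p (n - 2))) \<le> 2" if "f (Inner i) = 0"
    using that spoke(1)[of 0] spoke(1)[of 2] spoke(1)[of "n - 2"] inner(1)[of 0] inner(1)[of 2]
      inner(2)[of "n - 2"] inner(2)[of "n - 4"] outer(1)[of 0] outer(2)[of "n - 1"]
    unfolding n1 0 by linarith+
  show "f x \<le> 1" if "f (Inner i) = 0" "x \<in> {Inner (?p 2), Inner (?p (n - 2)), Outer i}"
    using that(2) I(1-3)[OF that(1)] by (elim insertE emptyE) simp_all
  show "f x \<le> 2" if "f (Inner i) = 0" "x \<in> {Inner i, Inner (?p 2), Inner (?p (n - 2)),
        Inner (?p 4), Inner (?p (n - 4)), Outer i, Outer (?p 1),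
        Outer (?p (n - 1)), Outer (?p 2), Outer (?p (n - 2))}"
    using that I[OF that(1)] by (elim insertE emptyE) simp_all
  have O: "f (Outer (?p 1)) \<le> 2" "f (Outer (?p (n - 1))) \<le> 2"
    "f (Outer (?p 2)) \<le> 2" "f (Outer (?p (n - 2))) \<le> 2" "f (Inner i) \<le> 2"
    "f (Inner (?p 1)) \<le> 2" "f (Inner (?p (n - 1))) \<le> 2"
    "f (Inner (?p 2)) \<le> 2" "f (Inner (?p (n - 2))) \<le> 2" if "f (Outer i) = 0"
    using that spoke(2)[of 0] spoke(2)[of 1] spoke(2)[of "n - 1"] inner(1)[of 0] inner(2)[of "n - 2"]
      outer(1)[of 0] outer(1)[of 1] outer(2)[of "n - 1"] outer(2)[of "n - 2"]
    unfolding n1 0 by linarith+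
  show "f x \<le> 2" if "f (Outer i) = 0" "x \<in> {Outer i, Outer (?p 1), Outer (?p (n - 1)),
        Outer (?p 2), Outer (?p (n - 2)), Inner i, Inner (?p 1),
        Inner (?p (n - 1)), Inner (?p 2), Inner (?p (n - 2))}"
    using that O[OF that(1)] by (elim insertE emptyE) simp_all
qed

text \<open>Rotating back by \<open>i\<close> moves the first landmark to index 0 and does not
  change the kind of the second.\<close>

lemma petersen_coordinates_at_origin:
  assumes "petersen_coordinates n X Y (Inner i) b k"
  obtains X' Y' b' where "petersen_coordinates n X' Y' (Inner 0) b' k"
    and "(\<exists>j. b = Inner j) \<longleftrightarrow> (\<exists>j. b' = Inner j)"
proof -
  interpret petersen_coordinates n X Y "Inner i" b k by fact
  have i: "i < n" using landmarks by simp
  have "rotate_vertex n i (rotate_vertex n (n - i) b) = b"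
    using rotate_vertex_inverse(1)[OF landmarks(2)] i by simp
  then have "petersen_coordinates n X Y (rotate_vertex n i (Inner 0))
      (rotate_vertex n i (rotate_vertex n (n - i) b)) k"
    using assms i by simp
  from petersen_coordinates_rotate[OF this] that show thesis
    using i landmarks(2) by (cases b) auto
qed

text \<open>For \<open>n \<ge> 5\<close> the offsets 0, 1, -1, 2, -2 are distinct modulo
  \<open>n\<close>, so the ball around an outer vertex has ten vertices, one too many.\<close>

lemma petersen_coordinates_Outer:
  assumes "petersen_coordinates n X Y (Outer i) b k"
  shows False
proof -
  interpret petersen_coordinates n X Y "Outer i" b k by fact
  have i: "i < n" using landmarks by simp
  let ?b = "rotate_vertex n (n - i) b"
  have "rotate_vertex n i ?b = b"
    using rotate_vertex_inverse(1)[OF landmarks(2)] i by simp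
  then have *: "petersen_coordinates n X Y (rotate_vertex n i (Outer 0)) (rotate_vertex n i ?b) k"
    using assms i by simp
  let ?X = "\<lambda>x. X (rotate_vertex n i x)" and ?Y = "\<lambda>x. Y (rotate_vertex n i x)"
  have "petersen_coordinates n ?X ?Y (Outer 0) ?b k"
    using petersen_coordinates_rotate[OF *] i landmarks(2) by (simp add: rotate_vertex_in_pverts)
  then interpret O: petersen_coordinates n ?X ?Y "Outer 0" ?b k .
  let ?S = "{Outer 0, Outer 1, Outer (n - 1), Outer 2, Outer (n - 2),
    Inner 0, Inner 1, Inner (n - 1), Inner 2, Inner (n - 2)}"
  have "?X x \<le> 2" if "x \<in> ?S" for x
    by (rule petersen_ball(3)[where f = ?X and n = n and i = 0, OF O.lipschitz(1)])
      (use n that O.zero(1)[of "Outer 0"] in \<open>simp_all add: numeral_2_eq_2\<close>)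
  then have "card ?S \<le> 9" using n by (intro O.card_near) auto
  moreover have "card ?S = 10" using n by (auto simp: card_insert_if)
  ultimately show False by simp
qed

text \<open>Around an inner vertex the offsets 4 and -4 occur too; coincidences arise only if 4
  equals -2 (\<open>n = 6\<close>) or -4 (\<open>n = 8\<close>).\<close>

lemma petersen_coordinates_Inner_cases:
  assumes "petersen_coordinates n X Y (Inner 0) b k"
  shows "n = 6 \<or> n = 8"
proof (rule ccontr)
  assume n68: "\<not> (n = 6 \<or> n = 8)"
  interpret petersen_coordinates n X Y "Inner 0" b k by fact
  let ?S = "{Inner 0, Inner 2, Inner (n - 2), Inner 4, Inner (n - 4),
    Outer 0, Outer 1, Outer (n - 1), Outer 2, Outer (n - 2)}"
  have "X x \<le> 2" if "x \<in> ?S" for x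
    by (rule petersen_ball(2)[where f = X and n = n and i = 0, OF lipschitz(1)])
      (use n that zero(1)[of "Inner 0"] in \<open>simp_all add: numeral_2_eq_2\<close>)
  then have "card ?S \<le> 9" using n by (intro card_near) auto
  moreover have "card ?S = 10"
  proof -
    have d: "n - 4 \<noteq> 0" "n - 4 \<noteq> 2" "n - 4 \<noteq> 4" "n - 4 \<noteq> n - 2" "n - 2 \<noteq> 0" "n - 2 \<noteq> 1"
      "n - 2 \<noteq> 2" "n - 2 \<noteq> 4" "n - 1 \<noteq> 0" "n - 1 \<noteq> 1" "n - 1 \<noteq> 2" "n - 1 \<noteq> n - 2"
      "(0 :: nat) \<noteq> 1" "(0 :: nat) \<noteq> 2" "(0 :: nat) \<noteq> 4" "(1 :: nat) \<noteq> 2" "(2 :: nat) \<noteq> 4"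
      using n n68 by arith+
    let ?xs = "[Inner 0, Inner 2, Inner (n - 2), Inner 4, Inner (n - 4),
      Outer 0, Outer 1, Outer (n - 1), Outer 2, Outer (n - 2)]"
    have "distinct ?xs"
      by (simp only: distinct.simps list.set insert_iff empty_iff petersen_vertex.inject
          petersen_vertex.distinct d d[THEN not_sym] simp_thms)
    from distinct_card[OF this] show ?thesis by simp
  qed
  ultimately show False by simp
qed

section \<open>The cases \<open>n = 6\<close> and \<open>n = 8\<close>\<close>

definition inner_neighbours :: "nat \<Rightarrow> nat \<Rightarrow> petersen_vertex set" where
  "inner_neighbours n i = {Inner ((i + 2) mod n), Inner ((i + (n - 2)) mod n), Outer i}"

text \<open>Coinciding entries collapse: the set has 8 elements for \<open>n = 6\<close> and 9 for
  \<open>n = 8\<close>.\<close>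

definition inner_ball :: "nat \<Rightarrow> nat \<Rightarrow> petersen_vertex set" where
  "inner_ball n i = {Inner i, Inner ((i + 2) mod n), Inner ((i + (n - 2)) mod n),
     Inner ((i + 4) mod n), Inner ((i + (n - 4)) mod n), Outer i, Outer ((i + 1) mod n),
     Outer ((i + (n - 1)) mod n), Outer ((i + 2) mod n), Outer ((i + (n - 2)) mod n)}"

lemma inner_ball_subset: "i < n \<Longrightarrow> inner_ball n i \<subseteq> pverts (petersen n 2)"
  by (simp add: inner_ball_def)

lemma inner_neighbours_subset: "i < n \<Longrightarrow> inner_neighbours n i \<subseteq> pverts (petersen n 2)"
  by (simp add: inner_neighbours_def)

context petersen_coordinates
begin

lemma inner_neighbours_near:
  assumes "a = Inner i" "x \<in> inner_neighbours n i"
  shows "X x \<le> 1"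
  by (rule petersen_ball(1)[where f = X and n = n and i = i, OF lipschitz(1)])
    (use assms n landmarks zero(1)[of a] in \<open>simp_all add: inner_neighbours_def\<close>)

lemma inner_ball_near:
  assumes "a = Inner i" "x \<in> inner_ball n i"
  shows "X x \<le> 2"
  by (rule petersen_ball(2)[where f = X and n = n and i = i, OF lipschitz(1)])
    (use assms n landmarks zero(1)[of a] in \<open>simp_all add: inner_ball_def\<close>)

text \<open>The three neighbours of \<open>a\<close> in \<open>P(n,2)\<close> exhaust the three
  points with first coordinate 1, so the supergraph gives \<open>a\<close> no further
  neighbour.\<close>

lemma unit_sphere_eq_inner_neighbours:
  assumes a: "a = Inner i" and card: "card (inner_neighbours n i) = 3" "a \<notin> inner_neighbours n i"
    and x: "x \<in> pverts (petersen n 2)" "X x = 1"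
  shows "x \<in> inner_neighbours n i"
proof (rule ccontr)
  assume "x \<notin> inner_neighbours n i"
  then have "card (insert x (inner_neighbours n i)) = 4"
    using card(1) by (simp add: inner_neighbours_def)
  moreover have "card (insert x (inner_neighbours n i)) \<le> 3"
  proof (rule card_unit_sphere)
    have "i < n" using a landmarks by simp
    then show sub: "insert x (inner_neighbours n i) \<subseteq> pverts (petersen n 2)"
      using x inner_neighbours_subset by blast
    show "X y = 1" if y: "y \<in> insert x (inner_neighbours n i)" for y
    proof (cases "y = x")
      case False
      then have "y \<in> inner_neighbours n i" using y by simp
      then have "X y \<le> 1" "y \<noteq> a" using inner_neighbours_near[OF a] card(2) by auto
      moreover have "y \<in> pverts (petersen n 2)" using sub y by (rule subsetD)
      ultimately have "X y \<noteq> 0" by (simp add: zero(1))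
      with \<open>X y \<le> 1\<close> show ?thesis by simp
    qed (simp add: x)
  qed
  ultimately show False by simp
qed

end

text \<open>Eight vertices within distance 2 force \<open>k \<ge> 2\<close>, which excludes even
  \<open>c\<close>, where the landmarks are adjacent. For odd \<open>c\<close> the two balls share
  four vertices, so \<open>k = 2\<close>; then the point \<open>(1, 1)\<close> must be occupied,
  although the neighbourhoods of the landmarks are disjoint.\<close>

lemma not_petersen_coordinates_6: "\<not> petersen_coordinates 6 X Y (Inner 0) (Inner c) k"
proof
  assume "petersen_coordinates 6 X Y (Inner 0) (Inner c) k"
  then interpret petersen_coordinates 6 X Y "Inner 0" "Inner c" k .
  interpret swapped: petersen_coordinates 6 Y X "Inner c" "Inner 0" k by (rule swap)
  have "c < 6" "c \<noteq> 0" using landmarks by auto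
  then consider (even) "c = 2 \<or> c = 4" | (odd) "c = 1 \<or> c = 3 \<or> c = 5" by linarith
  note c_cases = this
  have S: "inner_ball 6 0 \<subseteq> pverts (petersen 6 2)" "\<And>x. x \<in> inner_ball 6 0 \<Longrightarrow> X x \<le> 2"
    using inner_ball_subset inner_ball_near by simp_all
  have S_eq: "inner_ball 6 0 = {Inner 0, Inner 2, Inner 4, Outer 0, Outer 1, Outer 2, Outer 4, Outer 5}"
    by (auto simp: inner_ball_def)
  have "card (inner_ball 6 0) = 8" by (simp add: S_eq)
  then have "\<not> k \<le> 1" using card_near_adjacent[OF _ S] by auto
  then have k2: "2 \<le> k" by simp
  from c_cases show False
  proof cases
    case even
    then have "Inner c \<in> inner_neighbours 6 0" by (auto simp: inner_neighbours_def)
    then have "X (Inner c) \<le> 1" using inner_neighbours_near by blast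
    then show False using between k2 by simp
  next
    case odd
    let ?C = "inner_ball 6 0 \<inter> inner_ball 6 c"
    have "card ?C = 4" using odd by (elim disjE; simp add: inner_ball_def)
    moreover have "card ?C \<le> 3" if "3 \<le> k"
    proof (rule card_common(1)[OF _ _ _ that])
      show "?C \<subseteq> pverts (petersen 6 2)" using S(1) by blast
      show "X x \<le> 2" "Y x \<le> 2" if "x \<in> ?C" for x
        using S(2) swapped.inner_ball_near that by auto
    qed
    ultimately have k: "k = 2" using k2 by linarith
    let ?T = "insert (Inner c) (inner_ball 6 0)"
    have T: "?T \<subseteq> pverts (petersen 6 2)" "\<And>x. x \<in> ?T \<Longrightarrow> X x \<le> 2"
      using S between k landmarks by auto
    have card_T: "card ?T = 9" using odd by (elim disjE; simp add: S_eq)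
    have "(1, 1) \<in> set near_points" unfolding near_points_def by (simp add: k)
    then obtain x where x: "x \<in> ?T" "(X x, Y x) = (1, 1)"
      using near_point_occupied[OF T card_T] by blast
    have xV: "x \<in> pverts (petersen 6 2)" using T(1) x(1) by blast
    have "x \<in> inner_neighbours 6 0"
      using x(2) by (intro unit_sphere_eq_inner_neighbours xV) (simp_all add: inner_neighbours_def)
    moreover have "x \<in> inner_neighbours 6 c"
      using x(2) odd by (intro swapped.unit_sphere_eq_inner_neighbours xV)
        (elim disjE; simp add: inner_neighbours_def)+
    ultimately show False using odd by (elim disjE; auto simp: inner_neighbours_def)
  qed
qed

text \<open>Nine vertices within distance 2 again force \<open>k \<ge> 2\<close>. This excludes
  adjacent landmarks, and \<open>c = 4\<close> because of two common neighbours. For odd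
  \<open>c\<close> both balls are full, so the landmarks are at distance at least 3; counting common
  vertices leaves \<open>k = 3\<close> with two of them, but three points must be occupied
  there.\<close>

lemma not_petersen_coordinates_8: "\<not> petersen_coordinates 8 X Y (Inner 0) (Inner c) k"
proof
  assume "petersen_coordinates 8 X Y (Inner 0) (Inner c) k"
  then interpret petersen_coordinates 8 X Y "Inner 0" "Inner c" k .
  interpret swapped: petersen_coordinates 8 Y X "Inner c" "Inner 0" k by (rule swap)
  have c8: "c < 8" "c \<noteq> 0" using landmarks by auto
  then consider (near) "c = 2 \<or> c = 6" | (opposite) "c = 4" | (odd) "c = 1 \<or> c = 3 \<or> c = 5 \<or> c = 7"
    by linarith
  note c_cases = this
  have S: "inner_ball 8 0 \<subseteq> pverts (petersen 8 2)" "\<And>x. x \<in> inner_ball 8 0 \<Longrightarrow> X x \<le> 2"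
    using inner_ball_subset inner_ball_near by simp_all
  have T: "inner_ball 8 c \<subseteq> pverts (petersen 8 2)" "\<And>x. x \<in> inner_ball 8 c \<Longrightarrow> Y x \<le> 2"
    using inner_ball_subset swapped.inner_ball_near c8 by simp_all
  have S_eq: "inner_ball 8 0 = {Inner 0, Inner 2, Inner 4, Inner 6,
      Outer 0, Outer 1, Outer 2, Outer 6, Outer 7}"
    by (auto simp: inner_ball_def)
  have card: "card (inner_ball 8 0) = 9" by (simp add: S_eq)
  then have "\<not> k \<le> 1" using card_near_adjacent[OF _ S] by auto
  then have k2: "2 \<le> k" by simp
  from c_cases show False
  proof cases
    case near
    then have "Inner c \<in> inner_neighbours 8 0" by (auto simp: inner_neighbours_def)
    then have "X (Inner c) \<le> 1" using inner_neighbours_near by blast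
    then show False using between k2 by simp
  next
    case opposite
    have "{Inner 2, Inner 6} \<subseteq> inner_neighbours 8 0 \<inter> inner_neighbours 8 c"
      by (simp add: inner_neighbours_def opposite)
    then have "card {Inner 2, Inner 6} \<le> 1"
      using inner_neighbours_near swapped.inner_neighbours_near k2
      by (intro card_common_neighbours) auto
    then show False by simp
  next
    case odd
    then have "Inner c \<notin> inner_ball 8 0" by (auto simp: S_eq)
    then have "\<not> X (Inner c) \<le> 2" using near_in_full_ball[OF S card] landmarks by blast
    then have k3: "3 \<le> k" using between by simp
    let ?C = "inner_ball 8 0 \<inter> inner_ball 8 c"
    have C: "?C \<subseteq> pverts (petersen 8 2)" "\<And>x. x \<in> ?C \<Longrightarrow> X x \<le> 2" "\<And>x. x \<in> ?C \<Longrightarrow> Y x \<le> 2"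
      using S T by auto
    have "card ?C = 4 \<or> card ?C = 2" and card_T: "card (inner_ball 8 c) = 9"
      using odd by (elim disjE; simp add: inner_ball_def)+
    moreover have "card ?C \<le> 3" "4 \<le> k \<Longrightarrow> card ?C \<le> 1" using card_common[OF C] k3 by simp_all
    ultimately have C2: "card ?C = 2" and k: "k = 3" using k3 by linarith+
    \<comment> \<open>All three points belong to \<open>near_points\<close> for
      \<open>k = 3\<close>, so each is occupied in the full ball around \<open>Inner 0\<close>; its
      second coordinate is at most 2, which puts the vertex in the other full ball too.\<close>
    have "p \<in> (\<lambda>x. (X x, Y x)) ` ?C" if p: "p \<in> {(1, 2), (2, 1), (2, 2)}" for p
    proof -
      have "p \<in> set near_points" using p unfolding near_points_def by (auto simp: k)
      then obtain x where x: "x \<in> inner_ball 8 0" "(X x, Y x) = p"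
        using near_point_occupied[OF S card] by blast
      have xV: "x \<in> pverts (petersen 8 2)" using S(1) x(1) by (rule subsetD)
      have "Y x \<le> 2" using x(2) p by auto
      then have "x \<in> inner_ball 8 c"
        using swapped.near_in_full_ball[OF T card_T xV] by blast
      with x(1) have "x \<in> ?C" by (rule IntI)
      with x(2) show ?thesis by (intro image_eqI[of _ _ x]) simp_all
    qed
    then have "{(1, 2), (2, 1), (2, 2)} \<subseteq> (\<lambda>x. (X x, Y x)) ` ?C" by (rule subsetI)
    moreover have "finite ?C" by (simp add: inner_ball_def)
    ultimately have "card {(1, 2), (2, 1), (2, 2) :: nat \<times> nat} \<le> card ?C"
      by (rule surj_card_le[rotated])
    then show False using C2 by simp
  qed
qed

text \<open>By \<open>swap\<close> the exclusion of outer landmarks applies to both, after which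
  only the two exceptional values of \<open>n\<close> remain.\<close>

lemma not_petersen_coordinates: "\<not> petersen_coordinates n X Y a b k"
proof
  assume coords: "petersen_coordinates n X Y a b k"
  then obtain i where a: "a = Inner i" by (metis petersen_coordinates_Outer petersen_vertex.exhaust)
  obtain j where b: "b = Inner j"
    using petersen_coordinates.swap[OF coords] by (metis petersen_coordinates_Outer petersen_vertex.exhaust)
  obtain X' Y' c where "petersen_coordinates n X' Y' (Inner 0) (Inner c) k"
    using petersen_coordinates_at_origin[of n X Y i b k] coords b unfolding a by metis
  then show False
    using petersen_coordinates_Inner_cases not_petersen_coordinates_6 not_petersen_coordinates_8 by metis
qed

section \<open>The lower bound for spanning supergraphs\<close>

lemma has_walk_petersen:
  assumes "n \<ge> 5" "x \<in> pverts (petersen n 2)" "w \<in> pverts (petersen n 2)"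
  obtains k where "has_walk (petersen n 2) x w k"
proof -
  have P: "pair_graph (petersen n 2)" by (rule pair_graph_petersen) (use assms(1) in auto)
  have "graph_dist (petersen n 2) x w \<noteq> \<infinity>"
    using assms graph_dist_Inner graph_dist_Outer by (cases w) simp_all
  then have "\<exists>k. has_walk (petersen n 2) x w k"
    \<comment> \<open>Connectedness is read off the distance formulas: without walks the infimum
      would be infinite.\<close>
    by (rule contrapos_np) (simp add: graph_dist_eq_INF[OF P] top_ereal_def)
  with that show thesis by blast
qed

lemma metric_dimension_spanning_supergraph_ge_3:
  assumes n: "n \<ge> 5" and H: "pair_graph H"
    and sub: "spanning (with_proj (petersen n 2)) (with_proj H)"
  shows "3 \<le> metric_dimension H"
proof (rule ccontr)
  let ?V = "pverts (petersen n 2)"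
  assume "\<not> 3 \<le> metric_dimension H"
  moreover have "\<exists>W. resolving_set H W \<and> card W = metric_dimension H"
    unfolding metric_dimension_def by (rule LeastI_ex) (use resolving_set_pverts[OF H] in blast)
  ultimately obtain W where W: "resolving_set H W" "card W \<le> 2" by auto
  have P: "pair_graph (petersen n 2)" by (rule pair_graph_petersen) (use n in auto)
  have V: "pverts H = ?V" and arcs: "parcs (petersen n 2) \<subseteq> parcs H"
    using sub by (auto simp: spanning_def subgraph_def)
  interpret H: pair_graph H by (rule H)
  have "W \<subseteq> ?V" using W(1) by (simp add: resolving_set_def V)
  moreover have "2 \<le> card ?V" using n by (simp add: card_pverts_petersen)
  moreover have "finite ?V" by (simp add: pverts_petersen)
  \<comment> \<open>A resolving set with fewer than two vertices is padded to exactly two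
    landmarks.\<close>
  ultimately obtain B where B: "W \<subseteq> B" "B \<subseteq> ?V" "card B = 2"
    using exists_subset_between[of W 2 ?V] W(2) by blast
  then obtain a b where ab: "B = {a, b}" "a \<noteq> b" by (auto simp: card_2_iff)
  have ab_V: "a \<in> ?V" "b \<in> ?V" using B ab by auto

  \<comment> \<open>Walks of \<open>P(n,2)\<close> survive in \<open>H\<close>, so all its distances
    are finite and can be chosen as natural numbers \<open>D\<close>.\<close>
  have "\<forall>x w. \<exists>k. x \<in> ?V \<longrightarrow> w \<in> ?V \<longrightarrow> has_walk H x w k \<and> graph_dist H x w = ereal (real k)"
    by (metis has_walk_petersen[OF n] has_walk_mono[OF _ P H] graph_dist_attained[OF H] V arcs order_refl)
  then obtain D where D: "has_walk H x w (D x w)" "graph_dist H x w = ereal (real (D x w))"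
    if "x \<in> ?V" "w \<in> ?V" for x w
    by metis
  have D_le: "D x w \<le> k" if "x \<in> ?V" "w \<in> ?V" "has_walk H x w k" for x w k
    using graph_dist_le[OF H that(3)] D(2)[OF that(1,2)] by simp
  have D_sym: "D x w = D w x" if "x \<in> ?V" "w \<in> ?V" for x w
    using D_le[OF that has_walk_sym[OF H D(1)[OF that(2,1)]]]
      D_le[OF that(2,1) has_walk_sym[OF H D(1)[OF that]]] by (rule antisym)
  have D_zero: "D x w = 0 \<longleftrightarrow> x = w" if "x \<in> ?V" "w \<in> ?V" for x w
    using graph_dist_eq_0_iff[OF H, of x w] D(2)[OF that] that V by (simp add: zero_ereal_def)
  have D_triangle: "D x z \<le> D x y + D y z" if "x \<in> ?V" "y \<in> ?V" "z \<in> ?V" for x y z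
    by (rule D_le[OF that(1,3) has_walk_trans[OF H D(1)[OF that(1,2)] D(1)[OF that(2,3)]]])
  have D_arc: "D y w \<le> Suc (D x w)" if "(x, y) \<in> parcs (petersen n 2)" "w \<in> ?V" for x y w
  proof -
    have xy: "(x, y) \<in> parcs H" using that(1) arcs by blast
    then have x: "x \<in> ?V" and y: "y \<in> ?V" and yx: "(y, x) \<in> parcs H"
      unfolding V[symmetric] by (rule H.in_arcsD1, rule H.in_arcsD2, rule H.arcs_symmetric)
    have "has_walk H y w (Suc (D x w))"
      using yx D(1)[OF x that(2)] unfolding has_walk_Suc_iff[OF H] by blast
    then show ?thesis by (rule D_le[OF y that(2)])
  qed
  have "petersen_coordinates n (\<lambda>x. D x a) (\<lambda>x. D x b) a b (D a b)"
  proof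
    show "inj_on (\<lambda>x. (D x a, D x b)) ?V"
    proof (rule inj_onI, rule ccontr)
      fix x y assume xy: "x \<in> ?V" "y \<in> ?V" "x \<noteq> y" and eq: "(D x a, D x b) = (D y a, D y b)"
      then obtain w where w: "w \<in> W" "graph_dist H x w \<noteq> graph_dist H y w"
        using W(1) V unfolding resolving_set_def resolves_def by metis
      \<comment> \<open>Padding kept all of \<open>W\<close>, so the resolving vertex is one of the
        two landmarks.\<close>
      then have "w = a \<or> w = b" using B(1) ab(1) by blast
      with eq w(2) D(2) xy ab_V show False by auto
    qed
    fix x assume x: "x \<in> ?V"
    show "D x b \<le> D x a + D a b" using D_triangle x ab_V by blast
    show "D x a \<le> D x b + D a b" using D_triangle[of x b a] D_sym x ab_V by simp
    show "D a b \<le> D x a + D x b" using D_triangle[of a x b] D_sym[of x a] x ab_V by simp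
  qed (simp_all add: n ab_V ab D_zero D_arc D_sym[OF ab_V])
  then show False using not_petersen_coordinates by blast
qed

theorem theorem4p3:
  fixes n :: nat
  assumes "n \<ge> 5"
  shows "irreducible_graph (petersen n 2)"
proof -
  let ?P = "petersen n 2"
  have P: "pair_graph ?P" by (rule pair_graph_petersen) (use assms in auto)
  have ge: "3 \<le> metric_dimension H" if "pair_graph H" "spanning (with_proj ?P) (with_proj H)" for H
    using metric_dimension_spanning_supergraph_ge_3 assms that by blast
  have eq: "metric_dimension ?P = 3"
    using metric_dimension_petersen_le_3[OF assms] ge[OF P spanning_refl[OF P]] by (rule antisym)
  have "threshold_dimension ?P = 3"
    unfolding threshold_dimension_def
  \<comment> \<open>\<open>P(n,2)\<close> is a spanning supergraph of itself and attains the lower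
    bound that \<open>ge\<close> gives for all of them.\<close>
  proof (rule Least_equality)
    show "\<exists>H. pair_graph H \<and> spanning (with_proj ?P) (with_proj H) \<and> metric_dimension H = 3"
      using P spanning_refl[OF P] eq by (intro exI[of _ ?P] conjI)
  qed (use ge in blast)
  with eq show ?thesis by (simp add: irreducible_graph_def)
qed

end
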